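(* Let $P^l=([n],\{(n,n,+),(i,i+1,-)\mid i\in[n-1]\})$. The Ehrhart polynomial of the root polytope $\mathcal{P}(P^l)$ is $$L_{\mathcal{P}(P^l)}(t)=(-1)^n\left(\sum_{d=1}^{n}f^l(d)(-1)^d\left(\binom{d+t}{d}+\binom{d+t-1}{d}\right)+\sum_{d=1}^{n-1}f(d)(-1)^d\binom{d+t}{d}\right),$$ where $f^l(d)$ is the number of alternating weakly-well-structured graphs on the vertex set $[n]$ with $d$ edges one of which is a loop, and $f(d)$ is the number of alternating weakly-well-structured graphs on the vertex set $[n]$ with $d$ edges and no loops.
   Context: A signed graph on $[n]=\{1,\dots,n\}$ is a finite multigraph (loops allowed) with each edge labeled $+$ or $-$; all loops are labeled $+$. An edge with endpoints $i,j$ and sign $\epsilon$ is written $(i,j,\epsilon)=(j,i,\epsilon)$. A positive edge is incident with a positive sign to both endpoints; a negative edge is incident with a positive sign to its smaller endpoint and with a negative sign to its larger one. A graph is alternating if at every vertex all incident edges are incident with the same sign. A graph $H$ on $[n]$ with $p\le n$ edges is weakly-well-structured if: (i) $H$ is noncrossing, i.e. there are no $i<j<k<l$ with edges $(i,k,\epsilon_1),(j,l,\epsilon_2)$ of $H$; (ii) for any edges $(i,j,+),(k,l,+)$ with $i<j$, $k<l$: $i<l$ and $k<j$; (iii) for any edges $(i,i,+),(k,l,+)$ with $k<l$: $k\le i\le l$; (iv) there are no edges $(i,i,+),(k,j,-)$ with $k<i<j$; (v) there are no edges $(i,j,+),(k,l,-)$ with $k\le i<j\le l$; (vi) $H$ contains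 at most one loop and no nonloop cycles; (vii) $H$ contains a positive edge (possibly a loop) incident to vertex $1$. Let $e_1,\dots,e_n$ be the standard basis of $\mathbb{R}^n$. For $i\le j$ put $\mathrm{v}(i,j,-)=e_i-e_j$ (here $i<j$) and $\mathrm{v}(i,j,+)=e_i+e_j$. Let $\Phi^+=\{e_i-e_j,\ e_i+e_j,\ 2e_k : 1\le i<j\le n,\ k\in[n]\}$. The cone $\mathcal{C}(G)$ is the set of nonnegative combinations of the vectors $\mathrm{v}(e)$, $e\in E(G)$, and $\mathcal{P}(G)=\operatorname{ConvHull}(\{0\}\cup(\Phi^+\cap\mathcal{C}(G)))$; in particular $\mathcal{P}(P^l)=\operatorname{ConvHull}(\{0\}\cup\Phi^+)$ is the full type $C_n$ root polytope. For an integer polytope $\mathcal{P}\subset\mathbb{R}^n$, $L_{\mathcal{P}}(t)=\#(t\mathcal{P}\cap\mathbb{Z}^n)$, where $t\mathcal{P}=\{tx : x\in\mathcal{P}\}$ is the $t$-th dilate. *)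

theory Defs
  imports "HOL-Analysis.Analysis" "HOL-Library.Multiset"
begin

datatype edge_sign = Pos | Neg

text \<open>
  The edge $(i,j,\epsilon) = (j,i,\epsilon)$ is represented by the triple whose first component is
  the smaller endpoint. A graph on $[n]$ is the multiset of its edges; the vertex set is
  determined by $n$.
\<close>

type_synonym sedge = "nat \<times> nat \<times> edge_sign"

definition signed_graph :: "nat \<Rightarrow> sedge multiset \<Rightarrow> bool" where
  "signed_graph n E \<longleftrightarrow>
     (\<forall>(i, j, s) \<in># E. 1 \<le> i \<and> i \<le> j \<and> j \<le> n \<and> (i = j \<longrightarrow> s = Pos))"

definition endpoints :: "sedge \<Rightarrow> nat set" where
  "endpoints = (\<lambda>(i, j, s). {i, j})"

definition is_loop :: "sedge \<Rightarrow> bool" where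
  "is_loop = (\<lambda>(i, j, s). i = j)"

text \<open>Meaningful only when \<open>v\<close> is an endpoint; \<open>j\<close> is the larger one.\<close>

definition incidence_sign :: "sedge \<Rightarrow> nat \<Rightarrow> edge_sign" where
  "incidence_sign = (\<lambda>(i, j, s) v. if s = Neg \<and> v = j then Neg else Pos)"

definition alternating :: "sedge multiset \<Rightarrow> bool" where
  "alternating E \<longleftrightarrow>
     (\<forall>v. \<forall>a \<in># E. \<forall>b \<in># E. v \<in> endpoints a \<and> v \<in> endpoints b \<longrightarrow>
        incidence_sign a v = incidence_sign b v)"

text \<open>
  A cycle with at least two vertices, listed as distinct vertices \<open>vs\<close> and edges \<open>es\<close>, where
  \<open>es ! i\<close> joins \<open>vs ! i\<close> to its cyclic successor. The submultiset condition makes the edges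
  distinct as members of the multigraph, so two parallel edges form a cycle.
\<close>

definition has_nonloop_cycle :: "sedge multiset \<Rightarrow> bool" where
  "has_nonloop_cycle E \<longleftrightarrow>
     (\<exists>vs es. 2 \<le> length vs \<and> distinct vs \<and> length es = length vs \<and> mset es \<subseteq># E \<and>
        (\<forall>i < length vs. endpoints (es ! i) = {vs ! i, vs ! (Suc i mod length vs)}))"

definition noncrossing :: "sedge multiset \<Rightarrow> bool" where
  "noncrossing E \<longleftrightarrow>
     \<not> (\<exists>i j k l s s'. i < j \<and> j < k \<and> k < l \<and> (i, k, s) \<in># E \<and> (j, l, s') \<in># E)"

definition weakly_well_structured :: "nat \<Rightarrow> sedge multiset \<Rightarrow> bool" where
  "weakly_well_structured n E \<longleftrightarrow>
     signed_graph n E \<and> size E \<le> n \<and>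
     noncrossing E \<and>
     (\<forall>i j k l. (i, j, Pos) \<in># E \<and> (k, l, Pos) \<in># E \<and> i < j \<and> k < l \<longrightarrow> i < l \<and> k < j) \<and>
     (\<forall>i k l. (i, i, Pos) \<in># E \<and> (k, l, Pos) \<in># E \<and> k < l \<longrightarrow> k \<le> i \<and> i \<le> l) \<and>
     \<not> (\<exists>i j k. (i, i, Pos) \<in># E \<and> (k, j, Neg) \<in># E \<and> k < i \<and> i < j) \<and>
     \<not> (\<exists>i j k l. (i, j, Pos) \<in># E \<and> (k, l, Neg) \<in># E \<and> k \<le> i \<and> i < j \<and> j \<le> l) \<and>
     size (filter_mset is_loop E) \<le> 1 \<and> \<not> has_nonloop_cycle E \<and>
     (\<exists>i j. (i, j, Pos) \<in># E \<and> 1 \<in> endpoints (i, j, Pos))"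

definition num_aww_loop :: "nat \<Rightarrow> nat \<Rightarrow> nat" where
  "num_aww_loop n d =
     card {E. weakly_well_structured n E \<and> alternating E \<and> size E = d \<and>
              size (filter_mset is_loop E) = 1}"

definition num_aww_noloop :: "nat \<Rightarrow> nat \<Rightarrow> nat" where
  "num_aww_noloop n d =
     card {E. weakly_well_structured n E \<and> alternating E \<and> size E = d \<and>
              filter_mset is_loop E = {#}}"

definition loop_path :: "nat \<Rightarrow> sedge multiset" where
  "loop_path n = add_mset (n, n, Pos) {# (i, i + 1, Neg). i \<in># mset_set {1..n - 1} #}"

text \<open>
  The ambient space $\mathbf{R}^n$ is a Euclidean space \<open>'a\<close>, with
  \<open>e 1, \<dots>, e n\<close> the standard basis (\<open>bij_betw e {1..n} Basis\<close>).
\<close>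

definition edge_vector :: "(nat \<Rightarrow> 'a::euclidean_space) \<Rightarrow> sedge \<Rightarrow> 'a" where
  "edge_vector e = (\<lambda>(i, j, s). case s of Pos \<Rightarrow> e i + e j | Neg \<Rightarrow> e i - e j)"

definition positive_roots :: "(nat \<Rightarrow> 'a::euclidean_space) \<Rightarrow> nat \<Rightarrow> 'a set" where
  "positive_roots e n =
     {e i - e j | i j. 1 \<le> i \<and> i < j \<and> j \<le> n} \<union>
     {e i + e j | i j. 1 \<le> i \<and> i < j \<and> j \<le> n} \<union>
     {2 *\<^sub>R e k | k. 1 \<le> k \<and> k \<le> n}"

definition graph_cone :: "(nat \<Rightarrow> 'a::euclidean_space) \<Rightarrow> sedge multiset \<Rightarrow> 'a set" where
  "graph_cone e E =
     {\<Sum>a \<in> set_mset E. c a *\<^sub>R edge_vector e a | c. \<forall>a \<in># E. (0::real) \<le> c a}"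

definition root_polytope ::
    "(nat \<Rightarrow> 'a::euclidean_space) \<Rightarrow> nat \<Rightarrow> sedge multiset \<Rightarrow> 'a set" where
  "root_polytope e n E = convex hull ({0} \<union> (positive_roots e n \<inter> graph_cone e E))"

definition integer_points :: "'a::euclidean_space set" where
  "integer_points = {x. \<forall>b \<in> Basis. x \<bullet> b \<in> \<int>}"

definition ehrhart :: "'a::euclidean_space set \<Rightarrow> nat \<Rightarrow> nat" where
  "ehrhart P t = card ((\<lambda>x. real t *\<^sub>R x) ` P \<inter> integer_points)"

end

theory Submission
  imports Defs "HOL-Computational_Algebra.Polynomial_FPS"
begin

text \<open>
  The polytope consists of the points with nonnegative partial sums and $\ell_1$-norm at most 2,
  so its Ehrhart function counts integer sequences $x_1, \dots, x_n$ with nonnegative partial sums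
  and $\sum |x_i| \le 2t$. Read $x_i > 0$ as $x_i$ opening and $x_i < 0$ as $|x_i|$ closing
  brackets at $i$. Matched brackets become negative edges, the remaining opening brackets are
  paired from the outside inwards into positive edges, and a bracket left over is half a loop. This
  is a bijection onto multisets of edges whose support satisfies the pairwise conditions, and a
  positive edge at 1 means that all partial sums are positive.

  Let $W_n$ and $S_n$ be the generating functions, by $\ell_1$-norm, of the sequences with
  nonnegative and with positive partial sums. Increasing $x_1$ by 1 gives $S_n = q W_n$ for
  $n \ge 1$, and cutting an arbitrary sequence after its last minimal partial sum gives
  $\sum_k W_k S_{n-k} = ((1 + q)/(1 - q))^n$. By induction on $n$ these two relations force
  $S_n(1/q) = (-1)^n W_n(q)$. The bijection writes $S_n$ as a sum over the graphs, so
  this reciprocity turns it into the alternating sum for $W_n$; the formula is the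
  coefficient of $q^{2t}$ in $W_n/(1-q)$.
\<close>

subsection \<open>Admissible edge sets\<close>

text \<open>The rooted graphs see only sequences with positive partial sums: their cells are open
  cones, in which every edge occurs at least once, and they partition the sequences counted by S_n,
  whereas the polytope asks for W_n. In S_n a nonloop edge contributes q^2/(1 - q^2) and a loop q/(1
  - q). Putting 1/q for q turns these into -1/(1 - q^2) and -1/(1 - q), minus the series of the
  closed cone; this is the origin of the sign (-1)^d. The identity 1/(1 - q) = (1 + q)/(1 - q^2),
  used once for the summation over the norm and once more for a loop, leaves (1 + q)/(1 - q^2)^(d+1)
  without a loop and (1 + q)^2/(1 - q^2)^(d+1) with one. Their coefficients at q^(2t) are the single
  binomial and the sum of two.

  A power series cannot be evaluated at 1/q, so the argument runs on (1 - q^2)^n S_n. That this is a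
  polynomial rests on d \<le> n, hence on the proof that the graphs are forests with at most one
  loop added.\<close>

definition compatible :: "sedge \<Rightarrow> sedge \<Rightarrow> bool" where
  "compatible = (\<lambda>(i, j, s) (k, l, s').
     \<not> (i < k \<and> k < j \<and> j < l) \<and>
     (s = Pos \<and> s' = Pos \<and> i < j \<and> k < l \<longrightarrow> i < l \<and> k < j) \<and>
     (s = Pos \<and> s' = Pos \<and> i = j \<and> k < l \<longrightarrow> k \<le> i \<and> i \<le> l) \<and>
     \<not> (s = Pos \<and> s' = Neg \<and> i = j \<and> k < i \<and> i < l) \<and>
     \<not> (s = Pos \<and> s' = Neg \<and> k \<le> i \<and> i < j \<and> j \<le> l) \<and>
     (i = j \<and> k = l \<longrightarrow> i = k) \<and>
     (\<forall>v. v \<in> {i, j} \<and> v \<in> {k, l} \<longrightarrow> (s = Neg \<and> v = j \<longleftrightarrow> s' = Neg \<and> v = l)))"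

text \<open>Only conditions on one or two edges are kept, so that subsets of admissible sets are
  admissible. \<open>compatible\<close> is not symmetric as written, hence the quantification over
  ordered pairs. Acyclicity and the bound on the number of edges are derived later from the pairwise
  conditions. The root condition, which subsets do not inherit, is kept apart in
  \<open>rooted\<close>.\<close>

definition admissible :: "nat \<Rightarrow> sedge set \<Rightarrow> bool" where
  "admissible n S \<longleftrightarrow>
     (\<forall>(i, j, s) \<in> S. 1 \<le> i \<and> i \<le> j \<and> j \<le> n \<and> (i = j \<longrightarrow> s = Pos)) \<and>
     (\<forall>a \<in> S. \<forall>b \<in> S. compatible a b)"

definition rooted :: "sedge set \<Rightarrow> bool" where
  "rooted S \<longleftrightarrow> (\<exists>j. (1, j, Pos) \<in> S)"

lemma admissible_subset: "admissible n S \<Longrightarrow> T \<subseteq> S \<Longrightarrow> admissible n T"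
  unfolding admissible_def by (meson subsetD)

lemma admissible_edge:
  assumes "admissible n S" "(i, j, s) \<in> S"
  shows "1 \<le> i" "i \<le> j" "j \<le> n" "i = j \<Longrightarrow> s = Pos" "s = Neg \<Longrightarrow> i < j"
  using assms unfolding admissible_def by (fastforce simp: le_less)+

lemma admissible_compatible:
  "admissible n S \<Longrightarrow> a \<in> S \<Longrightarrow> b \<in> S \<Longrightarrow> compatible a b"
  unfolding admissible_def by blast

context
  fixes n S assumes adm: "admissible n S"
begin

lemma admissible_noncrossing:
  "(i, j, s) \<in> S \<Longrightarrow> (k, l, s') \<in> S \<Longrightarrow> \<not> (i < k \<and> k < j \<and> j < l)"
  using admissible_compatible[OF adm, of "(i, j, s)" "(k, l, s')"] by (simp add: compatible_def)

lemma admissible_pos_pos: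
  "(i, j, Pos) \<in> S \<Longrightarrow> (k, l, Pos) \<in> S \<Longrightarrow> i < j \<Longrightarrow> k < l \<Longrightarrow> i < l \<and> k < j"
  using admissible_compatible[OF adm, of "(i, j, Pos)" "(k, l, Pos)"] by (simp add: compatible_def)

lemma admissible_loop_pos:
  "(i, i, Pos) \<in> S \<Longrightarrow> (k, l, Pos) \<in> S \<Longrightarrow> k < l \<Longrightarrow> k \<le> i \<and> i \<le> l"
  using admissible_compatible[OF adm, of "(i, i, Pos)" "(k, l, Pos)"] by (simp add: compatible_def)

lemma admissible_loop_neg:
  "(i, i, Pos) \<in> S \<Longrightarrow> (k, l, Neg) \<in> S \<Longrightarrow> \<not> (k < i \<and> i < l)"
  using admissible_compatible[OF adm, of "(i, i, Pos)" "(k, l, Neg)"] by (simp add: compatible_def)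

lemma admissible_pos_neg:
  "(i, j, Pos) \<in> S \<Longrightarrow> (k, l, Neg) \<in> S \<Longrightarrow> i < j \<Longrightarrow> \<not> (k \<le> i \<and> j \<le> l)"
  using admissible_compatible[OF adm, of "(i, j, Pos)" "(k, l, Neg)"] by (simp add: compatible_def)

lemma admissible_loop_loop:
  "(i, i, s) \<in> S \<Longrightarrow> (k, k, s') \<in> S \<Longrightarrow> i = k"
  using admissible_compatible[OF adm, of "(i, i, s)" "(k, k, s')"] by (simp add: compatible_def)

lemma admissible_alternating:
  assumes "(i, j, Neg) \<in> S" "(k, l, s) \<in> S"
  shows "j \<noteq> k" "s = Pos \<Longrightarrow> j \<noteq> l"
proof -
  have "k \<noteq> l \<or> s = Pos" using adm assms(2) unfolding admissible_def by blast
  moreover have "\<forall>v. v \<in> {i, j} \<and> v \<in> {k, l} \<longrightarrow> (v = j \<longleftrightarrow> s = Neg \<and> v = l)"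
    using admissible_compatible[OF adm assms] by (simp add: compatible_def)
  ultimately show "j \<noteq> k" "s = Pos \<Longrightarrow> j \<noteq> l" by auto
qed

end

lemma admissible_finite: "admissible n S \<Longrightarrow> finite S"
proof (rule finite_subset)
  assume "admissible n S"
  then show "S \<subseteq> {1..n} \<times> {1..n} \<times> {Pos, Neg}"
    unfolding admissible_def by (fastforce intro: edge_sign.exhaust)
qed simp

text \<open>A loop counts as the basis vector $e_i$, half of its root $2 e_i$: with these generators
  every integer point of a simplex is a nonnegative integer combination.\<close>

definition half_vec :: "sedge \<Rightarrow> nat \<Rightarrow> int" where
  "half_vec = (\<lambda>(i, j, s) v.
     of_bool (v = i) + (if i = j then 0 else if s = Pos then of_bool (v = j) else - of_bool (v = j)))"

definition mvec :: "sedge multiset \<Rightarrow> nat \<Rightarrow> int" where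
  "mvec M v = (\<Sum>a \<in># M. half_vec a v)"

lemma mvec_simps [simp]: "mvec {#} v = 0" "mvec (add_mset a M) v = half_vec a v + mvec M v"
  by (simp_all add: mvec_def)

lemma sum_mset_ge_member:
  fixes f :: "'b \<Rightarrow> int"
  assumes "a \<in># M" "\<And>b. b \<in># M \<Longrightarrow> 0 \<le> f b"
  shows "f a \<le> (\<Sum>b \<in># M. f b)"
proof -
  obtain N where N: "M = add_mset a N" using assms(1) by (metis insert_DiffM)
  have "0 \<le> (\<Sum>b \<in># N. f b)" using assms(2) unfolding N by (induction N) (auto, metis add_nonneg_nonneg)
  then show ?thesis by (simp add: N)
qed

text \<open>Alternation in vector form: contributions to one coordinate never cancel. Hence any
  single edge at v determines the sign of \<open>mvec M v\<close>, and no endpoint of an edge of M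
  is a zero of \<open>mvec M\<close>.\<close>

lemma half_vec_same_sign:
  assumes adm: "admissible n S" and "a \<in> S" "b \<in> S" "half_vec a v > 0"
  shows "half_vec b v \<ge> 0"
proof (rule ccontr)
  assume *: "\<not> ?thesis"
  obtain i j s k l s' where ab: "a = (i, j, s)" "b = (k, l, s')" by (metis prod_cases3)
  show False
    using * assms(4) admissible_compatible[OF adm assms(2,3)]
      admissible_edge[OF adm assms(2)[unfolded ab]] admissible_edge[OF adm assms(3)[unfolded ab]]
    unfolding ab half_vec_def compatible_def
    by (cases s; cases s') (auto simp: of_bool_def split: if_splits)
qed

lemma mvec_pos:
  assumes "admissible n (set_mset M)" "a \<in># M" "half_vec a v > 0"
  shows "mvec M v > 0"
proof -
  have "half_vec a v \<le> mvec M v" unfolding mvec_def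
    using half_vec_same_sign[OF assms(1,2) _ assms(3)] assms(2) by (intro sum_mset_ge_member) auto
  then show ?thesis using assms(3) by simp
qed

lemma mvec_neg:
  assumes "admissible n (set_mset M)" "a \<in># M" "half_vec a v < 0"
  shows "mvec M v < 0"
proof -
  have "- half_vec a v \<le> (\<Sum>b \<in># M. - half_vec b v)"
    using half_vec_same_sign[OF assms(1) _ assms(2)] assms(2,3)
    by (intro sum_mset_ge_member) (auto simp: not_less[symmetric])
  also have "\<dots> = - mvec M v" unfolding mvec_def by (induction M) auto
  finally show ?thesis using assms(3) by simp
qed


lemma mvec_posE:
  assumes "mvec M v > 0"
  obtains a where "a \<in># M" "half_vec a v > 0"
proof -
  have "\<exists>a. a \<in># M \<and> half_vec a v > 0"
    using assms by (induction M) (auto, smt (verit))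
  then show ?thesis using that by blast
qed

lemma mvec_negE:
  assumes "mvec M v < 0"
  obtains a where "a \<in># M" "half_vec a v < 0"
proof -
  have "\<exists>a. a \<in># M \<and> half_vec a v < 0"
    using assms by (induction M) (auto, smt (verit))
  then show ?thesis using that by blast
qed

lemma half_vec_left: "i \<le> j \<Longrightarrow> half_vec (i, j, s) i > 0"
  by (auto simp: half_vec_def)

lemma half_vec_right_pos: "i \<le> j \<Longrightarrow> half_vec (i, j, Pos) j > 0"
  by (auto simp: half_vec_def)

lemma half_vec_right_neg: "i < j \<Longrightarrow> half_vec (i, j, Neg) j < 0"
  by (auto simp: half_vec_def)

lemma half_vec_posD:
  "half_vec (i, j, s) v > 0 \<Longrightarrow> v = i \<or> (v = j \<and> s = Pos)"
  by (auto simp: half_vec_def split: if_splits)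

lemma half_vec_negD:
  "half_vec (i, j, s) v < 0 \<Longrightarrow> v = j \<and> i \<noteq> j \<and> s = Neg"
  by (cases s) (auto simp: half_vec_def of_bool_def split: if_splits)

text \<open>A greedy rule that depends on the vector alone. Every admissible multiset with vector x
  contains the edge peeled from x, which makes \<open>mvec\<close> injective; subtracting that edge
  from a walk leaves a smaller walk, which makes it surjective. Positive edges are peeled only when
  no negative entry is left, and when a single position remains the edge is a loop.\<close>

definition peels :: "(nat \<Rightarrow> int) \<Rightarrow> sedge \<Rightarrow> bool" where
  "peels x = (\<lambda>(i, j, s). x i > 0 \<and>
     (if s = Neg then i < j \<and> x j < 0 \<and> (\<forall>v < j. x v \<ge> 0) \<and> (\<forall>v. i < v \<and> v < j \<longrightarrow> x v = 0)
      else i \<le> j \<and> x j > 0 \<and> (\<forall>v. x v \<ge> 0) \<and> (\<forall>v. x v \<noteq> 0 \<longrightarrow> i \<le> v \<and> v \<le> j)))"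

text \<open>A closing bracket must be matched with the last opening bracket before it;
  unmatched opening brackets are paired from the outside inwards.\<close>

lemma peels_in_mset:
  assumes adm: "admissible n (set_mset M)" and "peels (mvec M) a"
  shows "a \<in># M"
proof -
  obtain i j s where a: "a = (i, j, s)" by (metis prod_cases3)
  note E = admissible_edge[OF adm]
  have vert: "mvec M k > 0 \<and> (r = Pos \<and> mvec M l > 0 \<or> r = Neg \<and> mvec M l < 0)" if "(k, l, r) \<in># M" for k l r
    using that E(2)[of k l r] E(5)[of k l r] mvec_pos[OF adm] mvec_neg[OF adm] half_vec_left
      half_vec_right_pos half_vec_right_neg by (cases r) blast+
  show ?thesis
  proof (cases s)
    case Neg
    then have p: "mvec M i > 0" "i < j" "mvec M j < 0" "\<forall>v < j. mvec M v \<ge> 0"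
      "\<forall>v. i < v \<and> v < j \<longrightarrow> mvec M v = 0"
      using assms(2) by (auto simp: peels_def a)
    obtain k where k: "(k, j, Neg) \<in># M" "k < j"
      using mvec_negE[OF p(3)] half_vec_negD E by (metis prod_cases3)
    have "k \<le> i" using p(5) k vert[OF k(1)] by (metis less_irrefl not_le)
    obtain b where b: "b \<in># M" "half_vec b i > 0" using mvec_posE[OF p(1)] .
    obtain k' l r where b': "b = (k', l, r)" by (metis prod_cases3)
    note b = b[unfolded b']
    show ?thesis
    proof (cases "k = i")
      case True then show ?thesis using k a Neg by simp
    next
      case False
      then have ki: "k < i" using \<open>k \<le> i\<close> by simp
      \<comment> \<open>Now k < i < j. A positive edge at i that reaches outside [k, j] crosses (k,
        j, Neg), and one that stays inside is forbidden as a loop under, or an edge nested in, a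
        negative edge. So the edge at i is negative and starts at i; it ends at j, since j is the
        first negative entry and an end beyond j would cross (k, j, Neg).\<close>
      show ?thesis
      proof (cases r)
        case Pos
        note b = b[unfolded Pos]
        have "\<not> (k < k' \<and> k' < j \<and> j < l)" "\<not> (k' < k \<and> k < l \<and> l < j)" "k' \<le> l"
          "\<not> (k' = l \<and> k < k' \<and> k' < j)" "\<not> (k \<le> k' \<and> k' < l \<and> l \<le> j)" "l \<noteq> j"
          using admissible_noncrossing[OF adm k(1) b(1)] admissible_noncrossing[OF adm b(1) k(1)]
            E(2)[OF b(1)] admissible_loop_neg[OF adm _ k(1), of k'] admissible_pos_neg[OF adm b(1) k(1)]
            admissible_alternating(2)[OF adm k(1) b(1)] b(1) by auto
        then show ?thesis using half_vec_posD[OF b(2)] ki p(2) by linarith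
      next
        case r: Neg
        note b = b[unfolded r]
        have "k' = i" using half_vec_posD[OF b(2)] by auto
        have "mvec M l < 0" using vert b(1) by blast
        then have "j \<le> l" using p(4) by (meson not_le)
        moreover have "\<not> j < l"
          using admissible_noncrossing[OF adm k(1) b(1)] ki \<open>k' = i\<close> p(2) by auto
        ultimately show ?thesis using b(1) \<open>k' = i\<close> a Neg by simp
      qed
    qed
  next
    case Pos
    then have p: "mvec M i > 0" "i \<le> j" "mvec M j > 0" "\<forall>v. mvec M v \<ge> 0"
      "\<forall>v. mvec M v \<noteq> 0 \<longrightarrow> i \<le> v \<and> v \<le> j"
      using assms(2) by (auto simp: peels_def a)
    have pos: "r = Pos \<and> i \<le> k \<and> k \<le> l \<and> l \<le> j" if "(k, l, r) \<in># M" for k l r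
    proof -
      have "r = Pos" using vert[OF that] p(4) by (metis not_le)
      then show ?thesis using vert[OF that] p(5) E(2)[OF that] by simp
    qed
    obtain b where b: "b \<in># M" "half_vec b i > 0" using mvec_posE[OF p(1)] .
    obtain k' l r where b': "b = (k', l, r)" by (metis prod_cases3)
    have l: "(i, l, Pos) \<in># M"
      using pos[OF b(1)[unfolded b']] half_vec_posD[OF b(2)[unfolded b']] b(1) b' by auto
    obtain c where c: "c \<in># M" "half_vec c j > 0" using mvec_posE[OF p(3)] .
    obtain k m r' where c': "c = (k, m, r')" by (metis prod_cases3)
    have k: "(k, j, Pos) \<in># M"
      using pos[OF c(1)[unfolded c']] half_vec_posD[OF c(2)[unfolded c']] c(1) c' by auto
    have q: "i \<le> l" "l \<le> j" "i \<le> k" "k \<le> j" using pos[OF l] pos[OF k] by auto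
    \<comment> \<open>One positive edge leaves i and one arrives at j. If both fell short of joining
      i to j, they would either cross or lie apart, and the conditions on pairs of positive edges,
      with or without loops, exclude the latter.\<close>
    have "l = j \<or> k = i"
    proof (cases "i = l"; cases "k = j")
      assume "i = l" "k = j"
      then show ?thesis using admissible_loop_loop[OF adm, of i Pos k] l k by auto
    next
      assume "i = l" "k \<noteq> j"
      then show ?thesis using admissible_loop_pos[OF adm, of i k j] l k q by auto
    next
      assume "i \<noteq> l" "k = j"
      then show ?thesis using admissible_loop_pos[OF adm, of k i l] l k q by auto
    next
      assume "i \<noteq> l" "k \<noteq> j"
      then show ?thesis using admissible_pos_pos[OF adm l k] admissible_noncrossing[OF adm l k] q
        by linarith
    qed
    then show ?thesis using l k a Pos by auto
  qed
qed

text \<open>Endpoints of edges of M are never zeros of \<open>mvec M\<close>, so the sign pattern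
  demanded by \<open>peels\<close> locates the edges of M. If a is negative, none of them has an
  endpoint strictly between i and j, and those that touch i or j do so with the right sign. If a is
  positive, all of them are positive and lie within [i, j]. Compatibility with a can then be read
  off.\<close>

lemma peels_insert:
  assumes adm: "admissible n (set_mset M)"
    and p: "peels (\<lambda>v. mvec M v + half_vec a v) a"
    and supp: "\<And>v. mvec M v + half_vec a v \<noteq> 0 \<Longrightarrow> 1 \<le> v \<and> v \<le> n"
  shows "admissible n (set_mset (add_mset a M))"
proof -
  obtain i j s where a: "a = (i, j, s)" by (metis prod_cases3)
  note E = admissible_edge[OF adm]
  have vert: "mvec M k > 0 \<and> (r = Pos \<and> mvec M l > 0 \<or> r = Neg \<and> mvec M l < 0)" if "(k, l, r) \<in># M" for k l r
    using that E(2)[of k l r] E(5)[of k l r] mvec_pos[OF adm] mvec_neg[OF adm] half_vec_left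
      half_vec_right_pos half_vec_right_neg by (cases r) blast+
  have val: "1 \<le> i \<and> i \<le> j \<and> j \<le> n \<and> (i = j \<longrightarrow> s = Pos)"
    using p supp[of i] supp[of j] unfolding peels_def a by (auto split: if_splits, (metis edge_sign.exhaust)+)
  have aa: "compatible a a" unfolding compatible_def a using val by (cases s) (auto split: if_splits)
  have "compatible a b \<and> compatible b a" if "b \<in># M" for b
  proof -
    obtain k l r where b: "b = (k, l, r)" by (metis prod_cases3)
    note bE = E[OF that[unfolded b]] and bv = vert[OF that[unfolded b]]
    show ?thesis
    proof (cases s)
      case Neg
      then have x: "i < j" "mvec M i \<ge> 0" "mvec M j \<le> 0" "\<And>v. v < j \<Longrightarrow> v \<noteq> i \<Longrightarrow> mvec M v \<ge> 0"
        "\<And>v. i < v \<Longrightarrow> v < j \<Longrightarrow> mvec M v = 0"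
        using p unfolding peels_def a half_vec_def by (auto simp: of_bool_def split: if_splits)
      have "\<not> (i < k \<and> k < j)" "\<not> (i < l \<and> l < j)" "k \<noteq> j" "l \<noteq> i \<or> r = Pos" "l \<noteq> j \<or> r = Neg"
        using x bv by force+
      then show ?thesis using x(1) Neg bE unfolding compatible_def a b by (cases r) auto
    next
      case Pos
      then have x: "i \<le> j" "\<And>v. mvec M v \<ge> 0" "\<And>v. mvec M v \<noteq> 0 \<Longrightarrow> i \<le> v \<and> v \<le> j"
        using p unfolding peels_def a half_vec_def
        by (fastforce simp: of_bool_def split: if_splits)+
      have "r = Pos" "i \<le> k" "k \<le> j" "i \<le> l" "l \<le> j" using x bv by (force simp: not_le[symmetric])+
      then show ?thesis using x(1) Pos bE unfolding compatible_def a b by auto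
    qed
  qed
  then show ?thesis using adm val aa unfolding admissible_def by (auto simp: a)
qed

subsection \<open>Edge multisets and integer walks\<close>

definition walk :: "nat \<Rightarrow> (nat \<Rightarrow> int) \<Rightarrow> bool" where
  "walk n x \<longleftrightarrow> (\<forall>v. v \<notin> {1..n} \<longrightarrow> x v = 0) \<and> (\<forall>k \<le> n. 0 \<le> (\<Sum>v = 1..k. x v))"

text \<open>The empty prefix is exempt, so that for n = 0 the zero function counts. This makes S_0 =
  1, and W_n appears as the term k = n of the convolution.\<close>

definition strict_walk :: "nat \<Rightarrow> (nat \<Rightarrow> int) \<Rightarrow> bool" where
  "strict_walk n x \<longleftrightarrow>
     (\<forall>v. v \<notin> {1..n} \<longrightarrow> x v = 0) \<and> (\<forall>k. 1 \<le> k \<and> k \<le> n \<longrightarrow> 0 < (\<Sum>v = 1..k. x v))"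

lemma half_vec_prefix:
  "1 \<le> i \<Longrightarrow> (\<Sum>v = 1..k. half_vec (i, j, s) v) =
     of_bool (i \<le> k) + (if i = j \<or> j < 1 then 0 else if s = Pos then of_bool (j \<le> k) else - of_bool (j \<le> k))"
proof -
  have 1: "(\<Sum>v = 1..k. of_bool (v = m)) = (of_bool (1 \<le> m \<and> m \<le> k) :: int)" for m
    by (simp add: of_bool_def)
  assume "1 \<le> i"
  then show ?thesis
    unfolding half_vec_def by (auto simp: 1 sum.distrib sum_negf)
qed

lemma mvec_prefix: "(\<Sum>v = 1..k. mvec M v) = (\<Sum>a \<in># M. \<Sum>v = 1..k. half_vec a v)"
  by (induction M) (simp_all add: sum.distrib)

lemma half_vec_prefix_nonneg:
  assumes "admissible n S" "a \<in> S"
  shows "0 \<le> (\<Sum>v = 1..k. half_vec a v)"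
proof -
  obtain i j s where a: "a = (i, j, s)" by (metis prod_cases3)
  show ?thesis using admissible_edge[OF assms[unfolded a]] unfolding a
    by (subst half_vec_prefix) (auto simp: of_bool_def)
qed

lemma walk_mvec:
  assumes adm: "admissible n (set_mset M)"
  shows "walk n (mvec M)"
  unfolding walk_def
proof (intro conjI allI impI)
  fix v assume v: "v \<notin> {1..n}"
  have "half_vec a v = 0" if "a \<in># M" for a
  proof -
    obtain i j s where a: "a = (i, j, s)" by (metis prod_cases3)
    show ?thesis using admissible_edge[OF adm that[unfolded a]] v
      unfolding a by (auto simp: half_vec_def)
  qed
  then show "mvec M v = 0" unfolding mvec_def by (induction M) auto
next
  fix k
  have "0 \<le> (\<Sum>v = 1..k. half_vec a v)" if "a \<in># M" for a
    using half_vec_prefix_nonneg[OF adm that] .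
  then show "0 \<le> (\<Sum>v = 1..k. mvec M v)" unfolding mvec_prefix
    by (induction M) (auto intro!: add_nonneg_nonneg)
qed

text \<open>At the first negative entry j the partial sum is still nonnegative, so some earlier
  entry is nonzero; the last such entry is the partner of j. Without negative entries the two
  extreme positions of the support are joined.\<close>

lemma peels_exists:
  assumes w: "walk n x" and "x v0 \<noteq> 0"
  obtains a where "peels x a"
proof (cases "\<exists>v. x v < 0")
  case True
  define j where "j = (LEAST v. x v < 0)"
  have j: "x j < 0" "\<And>v. v < j \<Longrightarrow> x v \<ge> 0"
    using LeastI_ex[OF True] not_less_Least unfolding j_def by (blast, force simp: not_less[symmetric])
  have "j \<in> {1..n}" using w j(1) unfolding walk_def by force
  then have "{1..j} = insert j {1..<j}" by auto
  then have "0 \<le> x j + (\<Sum>v \<in> {1..<j}. x v)"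
    using w \<open>j \<in> {1..n}\<close> unfolding walk_def by (metis atLeastAtMost_iff atLeastLessThan_iff finite_atLeastLessThan less_irrefl sum.insert)
  then have "(\<Sum>v \<in> {1..<j}. x v) \<noteq> 0" using j(1) by linarith
  then obtain i0 where i0: "i0 < j" "x i0 \<noteq> 0" by (meson atLeastLessThan_iff sum.neutral)
  define i where "i = Max {v. v < j \<and> x v \<noteq> 0}"
  have fin: "finite {v. v < j \<and> x v \<noteq> 0}" by simp
  have i: "i < j" "x i \<noteq> 0"
    using CollectD[OF Max_in[OF fin]] i0 unfolding i_def by blast+
  have "v \<le> i" if "v < j" "x v \<noteq> 0" for v
    unfolding i_def using that by (intro Max_ge[OF fin]) simp
  then have "x v = 0" if "i < v" "v < j" for v
    using that by (meson not_le)
  then have "peels x (i, j, Neg)" using i j unfolding peels_def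
    by (auto simp: order.strict_iff_order)
  then show ?thesis using that by blast
next
  case False
  define Z where "Z = {v. x v \<noteq> 0}"
  have "Z \<subseteq> {1..n}" using w unfolding Z_def walk_def by blast
  then have fin: "finite Z" by (rule finite_subset) simp
  have ne: "Z \<noteq> {}" using assms(2) unfolding Z_def by blast
  have nn: "x v \<ge> 0" for v using False by (metis not_le)
  have "x (Min Z) \<noteq> 0" "x (Max Z) \<noteq> 0" using Min_in[OF fin ne] Max_in[OF fin ne] by (auto simp: Z_def)
  then have pos: "x (Min Z) > 0" "x (Max Z) > 0" using nn by (metis order.not_eq_order_implies_strict)+
  moreover have "\<forall>v. x v \<noteq> 0 \<longrightarrow> Min Z \<le> v \<and> v \<le> Max Z"
    using Min_le[OF fin] Max_ge[OF fin] by (auto simp: Z_def)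
  ultimately have "peels x (Min Z, Max Z, Pos)" using nn unfolding peels_def by auto
  then show ?thesis using that by blast
qed

text \<open>Every entry of the peeled edge has the sign of the corresponding entry of x and is no
  larger. So peeling creates no new support, and the l1-norm drops: it is the measure that makes the
  induction in \<open>mvec_surj\<close> terminate.\<close>

lemma peels_abs:
  assumes "peels x a"
  shows "\<bar>x v - half_vec a v\<bar> = \<bar>x v\<bar> - \<bar>half_vec a v\<bar>"
proof -
  obtain i j s where a: "a = (i, j, s)" by (metis prod_cases3)
  show ?thesis using assms unfolding a peels_def half_vec_def
    by (cases s) (auto simp: of_bool_def split: if_splits)
qed

text \<open>A negative edge lowers only the partial sums with i \<le> k < j. All entries up to such
  a k are nonnegative and x i is at least 1, so there is room to subtract 1. When a positive edge is
  peeled, all entries stay nonnegative.\<close>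

lemma peels_walk:
  assumes w: "walk n x" and p: "peels x a"
  shows "walk n (\<lambda>v. x v - half_vec a v)"
  unfolding walk_def
proof (intro conjI allI impI)
  fix v assume "v \<notin> {1..n}"
  then have "x v = 0" using w unfolding walk_def by blast
  then show "x v - half_vec a v = 0" using peels_abs[OF p, of v] by simp
next
  fix k assume "k \<le> n"
  obtain i j s where a: "a = (i, j, s)" by (metis prod_cases3)
  have "x i > 0" using p unfolding peels_def a by auto
  then have "i \<in> {1..n}" using w unfolding walk_def by force
  show "0 \<le> (\<Sum>v = 1..k. x v - half_vec a v)"
  proof (cases s)
    case Pos
    have "0 \<le> x v - half_vec a v" for v
      using p Pos unfolding a peels_def half_vec_def by (auto simp: of_bool_def split: if_splits)
    then show ?thesis by (simp add: sum_nonneg)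
  next
    case Neg
    then have ij: "i < j" "\<And>v. v < j \<Longrightarrow> x v \<ge> 0" using p unfolding a peels_def by auto
    have pre: "(\<Sum>v = 1..k. half_vec a v) = (if i \<le> k \<and> k < j then 1 else 0)"
      using \<open>i \<in> {1..n}\<close> ij Neg unfolding a by (subst half_vec_prefix) (auto simp: of_bool_def)
    have "(if i \<le> k \<and> k < j then 1 else 0) \<le> (\<Sum>v = 1..k. x v)"
    proof (cases "i \<le> k \<and> k < j")
      case True
      have "x i \<le> (\<Sum>v = 1..k. x v)"
        using True ij(2) \<open>i \<in> {1..n}\<close> by (intro member_le_sum) auto
      then show ?thesis using True \<open>x i > 0\<close> by simp
    next
      case False then show ?thesis using w \<open>k \<le> n\<close> unfolding walk_def by auto
    qed
    then show ?thesis using pre by (simp add: sum_subtractf)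
  qed
qed

lemma mvec_eq_0_iff:
  assumes "admissible n (set_mset M)"
  shows "(\<forall>v. mvec M v = 0) \<longleftrightarrow> M = {#}"
proof
  assume z: "\<forall>v. mvec M v = 0"
  show "M = {#}"
  proof (rule ccontr)
    assume "M \<noteq> {#}"
    then obtain a where a: "a \<in># M" by blast
    obtain i j s where a': "a = (i, j, s)" by (metis prod_cases3)
    show False using mvec_pos[OF assms a] z half_vec_left[of i j s] admissible_edge[OF assms a[unfolded a']]
      unfolding a' by (metis less_irrefl)
  qed
qed simp

lemma inj_on_mvec: "inj_on mvec {M. admissible n (set_mset M)}"
proof (rule inj_onI; simp)
  fix M M' assume "admissible n (set_mset M)" "admissible n (set_mset M')" "mvec M = mvec M'"
  then show "M = M'"
  proof (induction "size M" arbitrary: M M')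
    case 0 then show ?case using mvec_eq_0_iff[of n M'] by (metis mvec_simps(1) size_eq_0_iff_empty)
  next
    case (Suc m)
    then have "M \<noteq> {#}" by auto
    then obtain v where "mvec M v \<noteq> 0" using mvec_eq_0_iff Suc.prems(1) by blast
    then obtain a where a: "peels (mvec M) a" using peels_exists walk_mvec Suc.prems(1) by metis
    have in1: "a \<in># M" using peels_in_mset[OF Suc.prems(1) a] .
    have in2: "a \<in># M'" using peels_in_mset[OF Suc.prems(2)] a Suc.prems(3) by metis
    obtain N where N: "M = add_mset a N" using in1 by (metis insert_DiffM)
    obtain N' where N': "M' = add_mset a N'" using in2 by (metis insert_DiffM)
    have "N = N'"
    proof (rule Suc.hyps(1))
      show "m = size N" using Suc.hyps(2) N by simp
      show "admissible n (set_mset N)" "admissible n (set_mset N')"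
        using Suc.prems N N' by (auto intro: admissible_subset)
      show "mvec N = mvec N'"
      proof
        fix v show "mvec N v = mvec N' v" using fun_cong[OF Suc.prems(3), of v] N N' by simp
      qed
    qed
    then show ?case using N N' by simp
  qed
qed

lemma mvec_surj:
  assumes "walk n x"
  obtains M where "admissible n (set_mset M)" "mvec M = x"
proof -
  have "\<exists>M. admissible n (set_mset M) \<and> mvec M = x"
    using assms
  proof (induction "nat (\<Sum>v = 1..n. \<bar>x v\<bar>)" arbitrary: x rule: less_induct)
    case less
    show ?case
    proof (cases "\<forall>v. x v = 0")
      case True
      then show ?thesis by (intro exI[of _ "{#}"]) (auto simp: admissible_def)
    next
      case False
      then obtain a where a: "peels x a" using peels_exists less.prems by blast
      define y where "y v = x v - half_vec a v" for v
      have y: "walk n y" unfolding y_def using peels_walk[OF less.prems a] .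
      obtain i j s where a': "a = (i, j, s)" by (metis prod_cases3)
      have "x i > 0" "i \<le> j" using a unfolding peels_def a' by (auto split: if_splits)
      then have "i \<in> {1..n}" using less.prems unfolding walk_def by force
      have "(\<Sum>v = 1..n. \<bar>y v\<bar>) < (\<Sum>v = 1..n. \<bar>x v\<bar>)"
      proof (rule sum_strict_mono_ex1)
        show "\<forall>v\<in>{1..n}. \<bar>y v\<bar> \<le> \<bar>x v\<bar>" using peels_abs[OF a] by (simp add: y_def)
        show "\<exists>v\<in>{1..n}. \<bar>y v\<bar> < \<bar>x v\<bar>"
          using \<open>i \<in> {1..n}\<close> peels_abs[OF a, of i] half_vec_left[OF \<open>i \<le> j\<close>, of s]
          by (intro bexI[of _ i]) (auto simp: y_def a')
      qed simp
      then have "nat (\<Sum>v = 1..n. \<bar>y v\<bar>) < nat (\<Sum>v = 1..n. \<bar>x v\<bar>)"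
        by (smt (verit) nat_less_eq_zless sum_nonneg abs_ge_zero)
      then obtain M where M: "admissible n (set_mset M)" "mvec M = y" using less.hyps y by blast
      have eq: "mvec M v + half_vec a v = x v" for v by (simp add: M y_def)
      have "admissible n (set_mset (add_mset a M))"
      proof (rule peels_insert[OF M(1)])
        show "peels (\<lambda>v. mvec M v + half_vec a v) a" using a by (simp add: eq)
        show "1 \<le> v \<and> v \<le> n" if "mvec M v + half_vec a v \<noteq> 0" for v
          using that less.prems unfolding eq walk_def by auto
      qed
      moreover have "mvec (add_mset a M) = x" using eq by (auto simp: add.commute)
      ultimately show ?thesis by blast
    qed
  qed
  then show ?thesis using that by blast
qed

text \<open>The $\ell_1$-norm of \<open>half_vec a\<close>.\<close>

definition weight :: "sedge \<Rightarrow> nat" where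
  "weight a = (if is_loop a then 1 else 2)"

definition total_weight :: "sedge multiset \<Rightarrow> nat" where
  "total_weight M = (\<Sum>a \<in># M. weight a)"

lemma total_weight_simps [simp]:
  "total_weight {#} = 0" "total_weight (add_mset a M) = weight a + total_weight M"
  by (simp_all add: total_weight_def)

text \<open>Since edges at a common vertex contribute with equal signs, absolute values add up over
  M coordinate by coordinate, and the norm is the sum of the norms of the edges.\<close>

lemma mvec_l1:
  assumes adm: "admissible n (set_mset M)"
  shows "(\<Sum>v = 1..n. \<bar>mvec M v\<bar>) = int (total_weight M)"
proof -
  have "\<bar>mvec M v\<bar> = (\<Sum>a \<in># M. \<bar>half_vec a v\<bar>)" for v
    using adm
  proof (induction M)
    case (add a M)
    have adm': "admissible n (set_mset M)" using add.prems by (auto intro: admissible_subset)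
    have "mvec M v \<ge> 0" if a: "half_vec a v > 0"
    proof (rule ccontr)
      assume "\<not> ?thesis"
      then obtain b where "b \<in># M" "half_vec b v < 0" using mvec_negE[of M v] by (auto simp: not_le)
      then show False using half_vec_same_sign[OF add.prems, of a b v] a by simp
    qed
    moreover have "mvec M v \<le> 0" if a: "half_vec a v < 0"
    proof (rule ccontr)
      assume "\<not> ?thesis"
      then obtain b where "b \<in># M" "half_vec b v > 0" using mvec_posE[of M v] by (auto simp: not_le)
      then show False using half_vec_same_sign[OF add.prems, of b a v] a by simp
    qed
    ultimately show ?case using add.IH[OF adm'] by (cases "half_vec a v" "0::int" rule: linorder_cases) auto
  qed simp
  then have "(\<Sum>v = 1..n. \<bar>mvec M v\<bar>) = (\<Sum>v = 1..n. \<Sum>a \<in># M. \<bar>half_vec a v\<bar>)" by simp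
  also have "\<dots> = (\<Sum>a \<in># M. \<Sum>v = 1..n. \<bar>half_vec a v\<bar>)"
    by (induction M) (simp_all add: sum.distrib)
  also have "\<dots> = (\<Sum>a \<in># M. int (weight a))"
  proof (intro arg_cong[where f = sum_mset] image_mset_cong)
    fix a assume a: "a \<in># M"
    obtain i j s where a': "a = (i, j, s)" by (metis prod_cases3)
    note E = admissible_edge[OF adm a[unfolded a']]
    have "(\<Sum>v = 1..n. \<bar>half_vec a v\<bar>) = (\<Sum>v = 1..n. of_bool (v = i) + (if i = j then 0 else of_bool (v = j)))"
      unfolding a' half_vec_def by (intro sum.cong) (auto simp: of_bool_def)
    also have "\<dots> = int (weight a)"
      using E unfolding a' weight_def is_loop_def by (auto simp: sum.distrib of_bool_def)
    finally show "(\<Sum>v = 1..n. \<bar>half_vec a v\<bar>) = int (weight a)" .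
  qed
  also have "\<dots> = int (total_weight M)" by (induction M) auto
  finally show ?thesis .
qed

text \<open>Every edge has nonnegative partial sums, and a positive edge at 1 contributes at least 1
  to each of them. Conversely, without such an edge the edges at 1 are all negative; let (1, l, Neg)
  be the longest. A positive partial sum at l needs a positive edge that starts by l, or a negative
  one that starts by l and ends beyond it. By the choice of l no such negative edge starts at 1; any
  other candidate crosses (1, l, Neg), meets l with the wrong sign, or is a positive edge or loop
  underneath it.\<close>

lemma rooted_iff_strict_walk:
  assumes adm: "admissible n (set_mset M)" and "1 \<le> n"
  shows "rooted (set_mset M) \<longleftrightarrow> strict_walk n (mvec M)"
proof
  assume "rooted (set_mset M)"
  then obtain j where j: "(1, j, Pos) \<in># M" unfolding rooted_def by blast
  have "0 < (\<Sum>v = 1..k. mvec M v)" if "1 \<le> k" for k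
  proof -
    have "(0::int) < (\<Sum>v = 1..k. half_vec (1, j, Pos) v)"
      using that by (subst half_vec_prefix) (auto simp: of_bool_def)
    also have "\<dots> \<le> (\<Sum>a \<in># M. \<Sum>v = 1..k. half_vec a v)"
      using j half_vec_prefix_nonneg[OF adm] by (intro sum_mset_ge_member) auto
    also have "\<dots> = (\<Sum>v = 1..k. mvec M v)" by (rule mvec_prefix[symmetric])
    finally show ?thesis .
  qed
  then show "strict_walk n (mvec M)" using walk_mvec[OF adm] unfolding walk_def strict_walk_def by blast
next
  assume st: "strict_walk n (mvec M)"
  show "rooted (set_mset M)"
  proof (rule ccontr)
    assume nr: "\<not> rooted (set_mset M)"
    note E = admissible_edge[OF adm]
    have pos1: "mvec M 1 > 0" using st \<open>1 \<le> n\<close> unfolding strict_walk_def by (auto dest: spec[of _ 1])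
    obtain b where b: "b \<in># M" "half_vec b 1 > 0" using mvec_posE[OF pos1] .
    obtain i l0 s where b': "b = (i, l0, s)" by (metis prod_cases3)
    have "i = 1" using half_vec_posD[OF b(2)[unfolded b']] E(1,2)[OF b(1)[unfolded b']] by linarith
    then have b0: "(1, l0, Neg) \<in># M" using nr b(1) b' unfolding rooted_def by (cases s) auto
    define L where "L = {l. (1, l, Neg) \<in># M}"
    have "L \<subseteq> {1..n}" using E unfolding L_def by force
    then have fin: "finite L" by (rule finite_subset) simp
    have ne: "L \<noteq> {}" using b0 unfolding L_def by blast
    define l where "l = Max L"
    have l: "(1, l, Neg) \<in># M" using Max_in[OF fin ne] unfolding l_def L_def by simp
    have lmax: "l' \<le> l" if "(1, l', Neg) \<in># M" for l' using Max_ge[OF fin] that unfolding l_def L_def by simp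
    have "0 < (\<Sum>v = 1..l. mvec M v)" using st E[OF l] unfolding strict_walk_def by simp
    then have "\<exists>a. a \<in># M \<and> 0 < (\<Sum>v = 1..l. half_vec a v)"
      unfolding mvec_prefix by (induction M) (auto, smt (verit))
    then obtain i j s where a: "(i, j, s) \<in># M" "0 < (\<Sum>v = 1..l. half_vec (i, j, s) v)"
      by (metis prod_cases3)
    note aE = E[OF a(1)]
    show False
    proof (cases s)
      case Neg
      then have "i \<le> l" "l < j" using a(2)[unfolded half_vec_prefix[OF aE(1)]] aE by (auto simp: of_bool_def split: if_splits)
      then show False
        using lmax[of j] a(1) Neg admissible_alternating(1)[OF adm l a(1)]
          admissible_noncrossing[OF adm l a(1)] aE(1) by (cases "i = 1") auto
    next
      case Pos
      note a = a[unfolded Pos]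
      have "i \<le> l" using a(2)[unfolded half_vec_prefix[OF aE(1)]] aE by (auto simp: of_bool_def split: if_splits)
      moreover have "i \<noteq> 1" using nr a(1) unfolding rooted_def by blast
      moreover have "l \<noteq> i" "l \<noteq> j" using admissible_alternating[OF adm l a(1)] by auto
      moreover have "\<not> (1 < i \<and> i < l \<and> l < j)" using admissible_noncrossing[OF adm l a(1)] by auto
      moreover have "\<not> (i < j \<and> j \<le> l)" using admissible_pos_neg[OF adm a(1) l] aE by auto
      moreover have "\<not> (i = j \<and> i < l)" using admissible_loop_neg[OF adm _ l, of i] a(1) aE(1) \<open>i \<noteq> 1\<close> by auto
      ultimately show False using aE by linarith
    qed
  qed
qed

subsection \<open>Alternating weakly-well-structured graphs\<close>

text \<open>Take a shortest negative edge (i, j), or a shortest edge if all are positive. Suppose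
  that each end is shared. By minimality the second edge at j starts left of i; the second edge at i
  then crosses an edge, lies as a positive edge within a negative one, or contradicts minimality.
  This leaf property yields both the edge bound and the absence of cycles.\<close>

lemma admissible_leaf:
  assumes adm: "admissible n S" and "T \<subseteq> S" "T \<noteq> {}" and nl: "\<forall>a \<in> T. \<not> is_loop a"
  obtains a v where "a \<in> T" "v \<in> endpoints a" "\<And>b. b \<in> T \<Longrightarrow> v \<in> endpoints b \<Longrightarrow> b = a"
proof (rule ccontr)
  note leaf = that
  assume nt: "\<not> thesis"
  have other: "\<exists>b \<in> T. v \<in> endpoints b \<and> b \<noteq> a" if "a \<in> T" "v \<in> endpoints a" for a v
    using leaf[OF that] nt by blast
  have admT: "admissible n T" using adm assms(2) by (rule admissible_subset)
  have lt: "i < j" if "(i, j, s) \<in> T" for i j s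
    using admissible_edge(2)[OF admT that] nl that by (force simp: is_loop_def)
  show False
  proof (cases "\<exists>i j. (i, j, Neg) \<in> T")
    case True
    then have "\<exists>x. (\<lambda>(i, j). (i, j, Neg) \<in> T) x" by auto
    then obtain x where "(\<lambda>(i, j). (i, j, Neg) \<in> T) x"
      "\<forall>y. (\<lambda>(i, j). (i, j, Neg) \<in> T) y \<longrightarrow> (\<lambda>(i, j). j - i) x \<le> (\<lambda>(i, j). j - i) y"
      using ex_has_least_nat[of "\<lambda>(i, j). (i, j, Neg) \<in> T"] by blast
    then obtain i j where a: "(i, j, Neg) \<in> T"
      and min: "\<And>k l. (k, l, Neg) \<in> T \<Longrightarrow> j - i \<le> l - k" by (cases x) auto
    obtain k l s where b: "(k, l, s) \<in> T" "j \<in> {k, l}" "(k, l, s) \<noteq> (i, j, Neg)"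
      using other[OF a, of j] by (auto simp: endpoints_def)
    have "l = j" "s = Neg" using admissible_alternating[OF admT a b(1)] b(2) by (auto, metis edge_sign.exhaust)
    then have b: "(k, j, Neg) \<in> T" "k \<noteq> i" using b by auto
    then have k: "k < i" using min[OF b(1)] lt[OF b(1)] lt[OF a] by linarith
    obtain p q r where c: "(p, q, r) \<in> T" "i \<in> {p, q}" "(p, q, r) \<noteq> (i, j, Neg)"
      using other[OF a, of i] by (auto simp: endpoints_def)
    show False
    proof (cases "i = p")
      case p: True
      have "q \<le> j" using admissible_noncrossing[OF admT b(1) c(1)] p k lt[OF a] by auto
      moreover have "r \<noteq> Neg" using c p min[of i q] \<open>q \<le> j\<close> lt[OF c(1)] by auto
      ultimately show False using admissible_pos_neg[OF admT _ a, of p q] c(1) p lt[OF c(1)]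
        by (cases r) auto
    next
      case False
      then have q: "q = i" using c(2) by auto
      have "r \<noteq> Neg" using admissible_alternating(1)[OF admT _ a, of p q] c(1) q by auto
      then have c: "(p, i, Pos) \<in> T" using c(1) q by (cases r) auto
      show False using admissible_noncrossing[OF admT c b(1)] admissible_pos_neg[OF admT c b(1)]
          lt[OF a] lt[OF c] k by linarith
    qed
  next
    case False
    then have posT: "s = Pos" if "(i, j, s) \<in> T" for i j s using that by (cases s) auto
    obtain a0 where "a0 \<in> T" using assms(3) by blast
    then have "\<exists>x. (\<lambda>(i, j). (i, j, Pos) \<in> T) x" using posT by (cases a0) fast
    then obtain x where "(\<lambda>(i, j). (i, j, Pos) \<in> T) x"
      "\<forall>y. (\<lambda>(i, j). (i, j, Pos) \<in> T) y \<longrightarrow> (\<lambda>(i, j). j - i) x \<le> (\<lambda>(i, j). j - i) y"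
      using ex_has_least_nat[of "\<lambda>(i, j). (i, j, Pos) \<in> T"] by blast
    then obtain i j where a: "(i, j, Pos) \<in> T"
      and min: "\<And>k l. (k, l, Pos) \<in> T \<Longrightarrow> j - i \<le> l - k" by (cases x) auto
    obtain k l s where b: "(k, l, s) \<in> T" "j \<in> {k, l}" "(k, l, s) \<noteq> (i, j, Pos)"
      using other[OF a, of j] by (auto simp: endpoints_def)
    have s: "s = Pos" using posT b(1) .
    note b = b[unfolded s]
    have "l = j" using admissible_pos_pos[OF admT a b(1) lt[OF a] lt[OF b(1)]] b(2) by auto
    then have k: "k < i" using b min[OF b(1)] lt[OF b(1)] lt[OF a] by auto
    obtain p q r where c: "(p, q, r) \<in> T" "i \<in> {p, q}" "(p, q, r) \<noteq> (i, j, Pos)"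
      using other[OF a, of i] by (auto simp: endpoints_def)
    have r: "r = Pos" using posT c(1) .
    note c = c[unfolded r]
    have "p = i" using admissible_pos_pos[OF admT c(1) a lt[OF c(1)] lt[OF a]] c(2) by auto
    then have "j < q" using c min[OF c(1)] lt[OF c(1)] lt[OF a] by auto
    then show False using admissible_noncrossing[OF admT b(1) c(1)] k \<open>l = j\<close> \<open>p = i\<close> lt[OF a] by auto
  qed
qed

lemma card_endpoints:
  assumes "\<not> is_loop a" shows "card (endpoints a) = 2"
  using assms by (cases a) (auto simp: is_loop_def endpoints_def)

text \<open>The edge bound of a forest, by removing a leaf edge together with the endpoint that it
  shares with no other edge.\<close>

lemma admissible_card_nonloops:
  assumes adm: "admissible n S"
  shows "T \<subseteq> S \<Longrightarrow> \<forall>a \<in> T. \<not> is_loop a \<Longrightarrow> finite V \<Longrightarrow> \<forall>a \<in> T. endpoints a \<subseteq> V \<Longrightarrow>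
    card T \<le> card V - 1"
proof (induction "card T" arbitrary: T V)
  case (Suc m)
  have fin: "finite T" using Suc.hyps(2) by (metis card.infinite nat.distinct(1))
  have "T \<noteq> {}" using Suc.hyps(2) by auto
  then obtain a v where av: "a \<in> T" "v \<in> endpoints a" "\<And>b. b \<in> T \<Longrightarrow> v \<in> endpoints b \<Longrightarrow> b = a"
    using admissible_leaf[OF adm Suc.prems(1) _ Suc.prems(2)] by metis
  have "card (T - {a}) \<le> card (V - {v}) - 1"
  proof (rule Suc.hyps(1))
    show "m = card (T - {a})" using Suc.hyps(2) av(1) fin by (simp add: card_Diff_singleton)
    show "\<forall>b \<in> T - {a}. endpoints b \<subseteq> V - {v}" using Suc.prems(4) av(3) by blast
  qed (use Suc.prems in blast)+
  \<comment> \<open>Keeps the subtractions of 1 on both sides from being truncated.\<close>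
  moreover have "2 \<le> card V"
    using card_endpoints[of a] Suc.prems av(1) by (metis card_mono)
  moreover have "v \<in> V" using av Suc.prems(4) by blast
  ultimately show ?case using fin av(1) Suc.prems(3) by (simp add: card_Diff_singleton)
qed simp

text \<open>On a cycle both endpoints of every edge are shared with a cyclic neighbour, against
  \<open>admissible_leaf\<close>. The neighbour is a different edge because the edges of a cycle
  taken from \<open>mset_set S\<close> are distinct.\<close>

lemma admissible_acyclic:
  assumes adm: "admissible n S"
  shows "\<not> has_nonloop_cycle (mset_set S)"
proof
  assume "has_nonloop_cycle (mset_set S)"
  then obtain vs es where c: "2 \<le> length vs" "distinct vs" "length es = length vs"
    "mset es \<subseteq># mset_set S"
    "\<And>i. i < length vs \<Longrightarrow> endpoints (es ! i) = {vs ! i, vs ! (Suc i mod length vs)}"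
    unfolding has_nonloop_cycle_def by blast
  define l where "l = length vs"
  note c = c[folded l_def]
  have fin: "finite S" using admissible_finite[OF adm] .
  have sub: "set es \<subseteq> S" using set_mset_mono[OF c(4)] fin by simp
  have dist: "distinct es"
  proof -
    have "count (mset es) a \<le> 1" for a
    proof -
      have "count (mset es) a \<le> count (mset_set S) a" using c(4) by (rule mset_subset_eq_count)
      also have "\<dots> \<le> 1" using fin by (cases "a \<in> S") auto
      finally show ?thesis .
    qed
    then show ?thesis unfolding distinct_count_atmost_1
      by (metis One_nat_def count_eq_zero_iff count_greater_zero_iff le_antisym less_eq_Suc_le set_mset_mset)
  qed
  have neq: "Suc i mod l \<noteq> i" if "i < l" for i
    using that c(1) by (cases "Suc i = l") auto
  have "\<forall>a \<in> set es. \<not> is_loop a"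
  proof
    fix a assume "a \<in> set es"
    then obtain i where i: "i < l" "a = es ! i" using c(3) by (metis in_set_conv_nth)
    have "Suc i mod l < l" using i(1) by (intro mod_less_divisor) linarith
    then have "vs ! i \<noteq> vs ! (Suc i mod l)"
      using neq[OF i(1)] i(1) c(1,2)
      by (subst nth_eq_iff_index_eq) (auto simp: l_def)
    then show "\<not> is_loop a" using c(5)[OF i(1)] i(2)
      by (cases a) (auto simp: is_loop_def endpoints_def)
  qed
  moreover have "set es \<noteq> {}" using c(1,3) by auto
  ultimately obtain a v where av: "a \<in> set es" "v \<in> endpoints a"
    "\<And>b. b \<in> set es \<Longrightarrow> v \<in> endpoints b \<Longrightarrow> b = a"
    using admissible_leaf[OF adm sub] by metis
  then obtain i where i: "i < l" "a = es ! i" using c(3) by (metis in_set_conv_nth)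
  have "\<exists>j < l. j \<noteq> i \<and> v \<in> endpoints (es ! j)"
  proof (cases "v = vs ! i")
    case True
    define j where "j = (if i = 0 then l - 1 else i - 1)"
    have "j < l" "j \<noteq> i" "Suc j mod l = i" using i(1) c(1) by (auto simp: j_def)
    then show ?thesis using c(5)[of j] True by (intro exI[of _ j]) auto
  next
    case False
    then have v: "v = vs ! (Suc i mod l)" using av(2) c(5)[OF i(1)] i(2) by auto
    have "Suc i mod l < l" using c(1) by simp
    then show ?thesis using c(5)[of "Suc i mod l"] neq[OF i(1)] v by (intro exI[of _ "Suc i mod l"]) auto
  qed
  then obtain j where j: "j < l" "j \<noteq> i" "v \<in> endpoints (es ! j)" by blast
  then have "es ! j = es ! i" using av(3) c(3) i(2) by (metis nth_mem)
  then show False using dist j i c(3) by (simp add: nth_eq_iff_index_eq)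
qed

lemma admissible_loops:
  assumes adm: "admissible n S" and "a \<in> S" "is_loop a"
  shows "{b \<in> S. is_loop b} = {a}"
proof -
  have "b = a" if b: "b \<in> S" "is_loop b" for b
  proof -
    obtain i s k s' where ab: "a = (i, i, s)" "b = (k, k, s')"
      using assms(3) b(2) by (cases a; cases b) (auto simp: is_loop_def)
    then have "s = Pos" "s' = Pos" using admissible_edge(4)[OF adm] assms(2) b(1) by blast+
    moreover have "i = k" using admissible_loop_loop[OF adm] ab assms(2) b(1) by blast
    ultimately show ?thesis using ab by simp
  qed
  then show ?thesis using assms by blast
qed

lemma admissible_card_loops:
  assumes adm: "admissible n S"
  shows "card {a \<in> S. is_loop a} \<le> 1"
proof (cases "\<exists>a \<in> S. is_loop a")
  case True
  then show ?thesis using admissible_loops[OF adm] by (metis card_1_singleton_iff le_refl One_nat_def)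
next
  case False
  then have "{a \<in> S. is_loop a} = {}" by blast
  then show ?thesis by (metis card.empty zero_le)
qed

lemma admissible_card_noloop:
  assumes adm: "admissible n S"
  shows "card {a \<in> S. \<not> is_loop a} \<le> n - 1"
proof -
  have "endpoints a \<subseteq> {1..n}" if "a \<in> S" for a
  proof -
    obtain i j s where a: "a = (i, j, s)" by (metis prod_cases3)
    show ?thesis using admissible_edge[OF adm that[unfolded a]] by (auto simp: a endpoints_def)
  qed
  then have "card {a \<in> S. \<not> is_loop a} \<le> card {1..n} - 1"
    by (intro admissible_card_nonloops[OF adm]) blast+
  then show ?thesis by simp
qed

lemma admissible_card:
  assumes adm: "admissible n S"
  shows "card S \<le> n"
proof (cases "S = {}")
  case False
  then obtain i j s where a: "(i, j, s) \<in> S" by (metis all_not_in_conv prod_cases3)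
  then have n: "1 \<le> n" using admissible_edge[OF adm a] by linarith
  have fin: "finite S" using admissible_finite[OF adm] .
  have "card {a \<in> S. is_loop a} \<le> 1" using admissible_card_loops[OF adm] .
  moreover have "card S = card {a \<in> S. is_loop a} + card {a \<in> S. \<not> is_loop a}"
    using fin by (subst card_Un_disjoint[symmetric]) (auto intro!: arg_cong[where f = card])
  ultimately show ?thesis using admissible_card_noloop[OF adm] n by linarith
qed simp

text \<open>Multisets reduce to sets: a repeated loop would count as two loops, and a repeated
  nonloop edge is a cycle of length two.\<close>

lemma aww_admissible:
  assumes w: "weakly_well_structured n E" and alt: "alternating E"
  shows "admissible n (set_mset E)" "rooted (set_mset E)" "E = mset_set (set_mset E)"
proof -
  have sg: "signed_graph n E" and nc: "noncrossing E"
    and ii: "\<And>i j k l. (i, j, Pos) \<in># E \<Longrightarrow> (k, l, Pos) \<in># E \<Longrightarrow> i < j \<Longrightarrow> k < l \<Longrightarrow> i < l \<and> k < j"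
    and iii: "\<And>i k l. (i, i, Pos) \<in># E \<Longrightarrow> (k, l, Pos) \<in># E \<Longrightarrow> k < l \<Longrightarrow> k \<le> i \<and> i \<le> l"
    and iv: "\<And>i j k. (i, i, Pos) \<in># E \<Longrightarrow> (k, j, Neg) \<in># E \<Longrightarrow> \<not> (k < i \<and> i < j)"
    and v: "\<And>i j k l. (i, j, Pos) \<in># E \<Longrightarrow> (k, l, Neg) \<in># E \<Longrightarrow> \<not> (k \<le> i \<and> i < j \<and> j \<le> l)"
    and lp: "size (filter_mset is_loop E) \<le> 1" and nocyc: "\<not> has_nonloop_cycle E"
    and root: "\<exists>i j. (i, j, Pos) \<in># E \<and> 1 \<in> endpoints (i, j, Pos)"
    using w unfolding weakly_well_structured_def by blast+
  have val: "1 \<le> i \<and> i \<le> j \<and> j \<le> n \<and> (i = j \<longrightarrow> s = Pos)" if "(i, j, s) \<in># E" for i j s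
    using sg that unfolding signed_graph_def by blast
  have loops: "a = b" if ab: "a \<in># E" "b \<in># E" "is_loop a" "is_loop b" for a b
  proof (rule ccontr)
    assume ne: "a \<noteq> b"
    obtain G where G: "E = add_mset a G" using multi_member_split[OF ab(1)] by blast
    then have "b \<in># G" using ne ab(2) by auto
    then obtain F where "G = add_mset b F" using multi_member_split by metis
    then have "E = add_mset a (add_mset b F)" using G by simp
    then have "size (filter_mset is_loop E) \<ge> 2" using ab(3,4) by simp
    then show False using lp by simp
  qed
  have "compatible (i, j, s) (k, l, s')" if a: "(i, j, s) \<in># E" and b: "(k, l, s') \<in># E" for i j s k l s'
    unfolding compatible_def prod.case
  proof (intro conjI impI allI)
    show "\<not> (i < k \<and> k < j \<and> j < l)" using nc a b unfolding noncrossing_def by blast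
    show "i = k" if "i = j \<and> k = l" using loops[OF a b] that by (simp add: is_loop_def)
    fix u assume "u \<in> {i, j} \<and> u \<in> {k, l}"
    then have "incidence_sign (i, j, s) u = incidence_sign (k, l, s') u"
      using alt a b unfolding alternating_def endpoints_def by blast
    then show "(s = Neg \<and> u = j) = (s' = Neg \<and> u = l)"
      unfolding incidence_sign_def by (auto split: if_splits)
  qed (use ii iii iv v a b in blast)+
  then show adm: "admissible n (set_mset E)" unfolding admissible_def using val by force
  show "rooted (set_mset E)" using root val unfolding rooted_def endpoints_def by force
  have "count E a \<le> 1" for a
  proof (rule ccontr)
    assume "\<not> ?thesis"
    then have two: "{#a, a#} \<subseteq># E" by (intro mset_subset_eqI) auto
    then have aE: "a \<in># E" by (meson insert_subset_eq_iff mset_subset_eqD union_single_eq_member)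
    obtain i j s where a: "a = (i, j, s)" by (metis prod_cases3)
    show False
    proof (cases "i = j")
      case True
      then have "filter_mset is_loop {#a, a#} = {#a, a#}" by (simp add: a is_loop_def)
      then have "2 \<le> size (filter_mset is_loop E)"
        using size_mset_mono[OF multiset_filter_mono[OF two, of is_loop]] by simp
      then show False using lp by simp
    next
      case False
      have "has_nonloop_cycle E" unfolding has_nonloop_cycle_def
        by (rule exI[of _ "[i, j]"], rule exI[of _ "[a, a]"])
          (use False two in \<open>auto simp: a endpoints_def less_Suc_eq\<close>)
      then show False using nocyc by blast
    qed
  qed
  then show "E = mset_set (set_mset E)"
    by (intro multiset_eqI) (metis One_nat_def count_eq_zero_iff count_mset_set(1) count_mset_set(3) finite_set_mset le_SucE le_zero_eq)
qed

lemma admissible_aww: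
  assumes adm: "admissible n S" and "rooted S"
  shows "weakly_well_structured n (mset_set S)" "alternating (mset_set S)"
proof -
  have fin: "finite S" using admissible_finite[OF adm] .
  have val: "1 \<le> i \<and> i \<le> j \<and> j \<le> n \<and> (i = j \<longrightarrow> s = Pos)" if "(i, j, s) \<in> S" for i j s
    using admissible_edge[OF adm that] by blast
  have "card {a \<in> S. is_loop a} \<le> 1" using admissible_card_loops[OF adm] .
  then have lp: "size (filter_mset is_loop (mset_set S)) \<le> 1"
    using fin by (simp add: filter_mset_mset_set)
  have m: "a \<in># mset_set S \<longleftrightarrow> a \<in> S" for a using fin by simp
  show "weakly_well_structured n (mset_set S)"
    unfolding weakly_well_structured_def
  proof (intro conjI)
    show "signed_graph n (mset_set S)" unfolding signed_graph_def using val fin by auto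
    show "size (mset_set S) \<le> n" using admissible_card[OF adm] by simp
    show "noncrossing (mset_set S)" unfolding noncrossing_def
      unfolding m using admissible_noncrossing[OF adm] by blast
    show "size (filter_mset is_loop (mset_set S)) \<le> 1" by (rule lp)
    show "\<not> has_nonloop_cycle (mset_set S)" by (rule admissible_acyclic[OF adm])
    show "\<exists>i j. (i, j, Pos) \<in># mset_set S \<and> 1 \<in> endpoints (i, j, Pos)"
      using \<open>rooted S\<close> fin unfolding rooted_def by (auto simp: endpoints_def)
    show "\<forall>i j k l. (i, j, Pos) \<in># mset_set S \<and> (k, l, Pos) \<in># mset_set S \<and> i < j \<and> k < l \<longrightarrow> i < l \<and> k < j"
      unfolding m using admissible_pos_pos[OF adm] by blast
    show "\<forall>i k l. (i, i, Pos) \<in># mset_set S \<and> (k, l, Pos) \<in># mset_set S \<and> k < l \<longrightarrow> k \<le> i \<and> i \<le> l"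
      unfolding m using admissible_loop_pos[OF adm] by blast
    show "\<nexists>i j k. (i, i, Pos) \<in># mset_set S \<and> (k, j, Neg) \<in># mset_set S \<and> k < i \<and> i < j"
      unfolding m using admissible_loop_neg[OF adm] by blast
    show "\<nexists>i j k l. (i, j, Pos) \<in># mset_set S \<and> (k, l, Neg) \<in># mset_set S \<and> k \<le> i \<and> i < j \<and> j \<le> l"
      unfolding m using admissible_pos_neg[OF adm] by blast
  qed
  show "alternating (mset_set S)" unfolding alternating_def
  proof (intro allI ballI impI)
    fix v a b assume ab: "a \<in># mset_set S" "b \<in># mset_set S" "v \<in> endpoints a \<and> v \<in> endpoints b"
    obtain i j s k l s' where e: "a = (i, j, s)" "b = (k, l, s')" by (metis prod_cases3)
    show "incidence_sign a v = incidence_sign b v"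
      using admissible_compatible[OF adm, of a b] ab fin unfolding e
      by (auto simp: compatible_def incidence_sign_def endpoints_def)
  qed
qed

text \<open>The parameter Q lets one bijection serve both counts, with and without a loop.\<close>

lemma card_alternating_wws:
  "card {E. weakly_well_structured n E \<and> alternating E \<and> Q E} =
   card {S. admissible n S \<and> rooted S \<and> Q (mset_set S)}"
proof -
  have "bij_betw mset_set {S. admissible n S \<and> rooted S \<and> Q (mset_set S)}
      {E. weakly_well_structured n E \<and> alternating E \<and> Q E}"
    by (rule bij_betw_byWitness[where f' = set_mset])
      (auto simp: admissible_finite aww_admissible(1,2) admissible_aww aww_admissible(3)[symmetric])
  then show ?thesis by (simp add: bij_betw_same_card)
qed

lemma num_aww_noloop_eq:
  "num_aww_noloop n d = card {S. admissible n S \<and> rooted S \<and> card S = d \<and> \<not> (\<exists>a \<in> S. is_loop a)}"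
  unfolding num_aww_noloop_def card_alternating_wws
  by (intro arg_cong[where f = card] Collect_cong) (auto simp: admissible_finite mset_set_empty_iff)

lemma num_aww_loop_eq:
  "num_aww_loop n d = card {S. admissible n S \<and> rooted S \<and> card S = d \<and> (\<exists>a \<in> S. is_loop a)}"
proof -
  have lp: "size (filter_mset is_loop (mset_set S)) = 1 \<longleftrightarrow> (\<exists>a \<in> S. is_loop a)" if "admissible n S" for S
  proof (cases "\<exists>a \<in> S. is_loop a")
    case True
    then have "card {a \<in> S. is_loop a} = 1" using admissible_loops[OF that] by force
    then show ?thesis using True admissible_finite[OF that] by simp
  next
    case False
    then have z: "filter_mset is_loop (mset_set S) = {#}"
      using admissible_finite[OF that] by (intro filter_mset_eq_mempty_iff[THEN iffD2]) simp
    show ?thesis unfolding z using False by simp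
  qed
  show ?thesis
    unfolding num_aww_loop_def card_alternating_wws size_mset_set
    by (intro arg_cong[where f = card] Collect_cong) (use lp in blast)
qed

subsection \<open>Generating functions\<close>

lemma size_le_total_weight: "size M \<le> total_weight M"
proof (induction M)
  case (add a M)
  then show ?case by (simp add: weight_def)
qed simp

lemma finite_total_weight:
  assumes "finite S"
  shows "finite {M. set_mset M \<subseteq> S \<and> total_weight M = m}"
proof (rule finite_subset)
  show "{M. set_mset M \<subseteq> S \<and> total_weight M = m} \<subseteq> mset ` {xs. set xs \<subseteq> S \<and> length xs \<le> m}"
  proof
    fix M assume M: "M \<in> {M. set_mset M \<subseteq> S \<and> total_weight M = m}"
    obtain xs where xs: "mset xs = M" using ex_mset by blast
    then have "set xs \<subseteq> S" "length xs \<le> m" using M size_le_total_weight[of M] by auto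
    then show "M \<in> mset ` {xs. set xs \<subseteq> S \<and> length xs \<le> m}" using xs by blast
  qed
  show "finite (mset ` {xs. set xs \<subseteq> S \<and> length xs \<le> m})"
    using finite_lists_length_le[OF assms] by blast
qed

text \<open>The support is required to equal S: every edge is used, which describes the integer
  points of an open cone. Distinct sets S therefore give disjoint families of multisets.\<close>

definition cell_fps :: "sedge set \<Rightarrow> real fps" where
  "cell_fps S = Abs_fps (\<lambda>m. real (card {M. set_mset M = S \<and> total_weight M = m}))"

text \<open>Taking one copy of a out of a multiset with support \<open>insert a S\<close> leaves
  either the same support or S. Iterating this writes \<open>cell_fps S\<close> as the product of
  q^w/(1 - q^w) over the weights w of the edges.\<close>

lemma cell_fps_insert:
  assumes fin: "finite S" and a: "a \<notin> S"
  shows "(1 - fps_X ^ weight a) * cell_fps (insert a S) = fps_X ^ weight a * cell_fps S"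
proof (rule fps_ext)
  fix m
  define N where "N T k = {M. set_mset M = T \<and> total_weight M = k}" for T k
  have finN: "finite (N T k)" if "finite T" for T k
    using finite_total_weight[OF that, of k] unfolding N_def by (rule finite_subset[rotated]) auto
  have eq: "card (N (insert a S) m) =
    (if m < weight a then 0 else card (N (insert a S) (m - weight a)) + card (N S (m - weight a)))"
  proof (cases "m < weight a")
    case True
    have "N (insert a S) m = {}"
    proof (rule ccontr)
      assume "N (insert a S) m \<noteq> {}"
      then obtain M where M: "set_mset M = insert a S" "total_weight M = m" unfolding N_def by blast
      then obtain M' where "M = add_mset a M'" by (metis insertI1 insert_DiffM)
      then show False using M True by simp
    qed
    then show ?thesis using True by simp
  next
    case False
    have "N (insert a S) m = add_mset a ` (N (insert a S) (m - weight a) \<union> N S (m - weight a))" (is "?L = ?R")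
    proof
      show "?L \<subseteq> ?R"
      proof
        fix M assume "M \<in> ?L"
        then have M: "set_mset M = insert a S" "total_weight M = m" unfolding N_def by auto
        then obtain M' where M': "M = add_mset a M'" by (metis insertI1 insert_DiffM)
        have "set_mset M' = insert a S \<or> set_mset M' = S" using M(1) M' a
          by (metis insert_absorb insert_ident set_mset_add_mset_insert)
        moreover have "total_weight M' = m - weight a" using M M' by simp
        ultimately show "M \<in> ?R" using M' unfolding N_def by blast
      qed
      show "?R \<subseteq> ?L"
      proof
        fix M assume "M \<in> ?R"
        then obtain M' where M': "M = add_mset a M'" "set_mset M' = insert a S \<or> set_mset M' = S"
          "total_weight M' = m - weight a" unfolding N_def by blast
        then have "set_mset M = insert a S" "total_weight M = m" using False by auto
        then show "M \<in> ?L" unfolding N_def by blast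
      qed
    qed
    moreover have "card (N (insert a S) (m - weight a) \<union> N S (m - weight a)) =
        card (N (insert a S) (m - weight a)) + card (N S (m - weight a))"
      using a finN fin by (intro card_Un_disjoint) (auto simp: N_def)
    ultimately show ?thesis using False by (simp add: card_image inj_on_def)
  qed
  show "fps_nth ((1 - fps_X ^ weight a) * cell_fps (insert a S)) m = fps_nth (fps_X ^ weight a * cell_fps S) m"
    using eq by (simp add: cell_fps_def left_diff_distrib fps_X_power_mult_nth N_def)
qed

lemma cell_fps_prod:
  "finite S \<Longrightarrow> (\<Prod>a \<in> S. 1 - fps_X ^ weight a) * cell_fps S = fps_X ^ (\<Sum>a \<in> S. weight a)"
proof (induction S rule: finite_induct)
  case empty
  have "{M. set_mset M = {} \<and> total_weight M = m} = (if m = 0 then {{#}} else {})" for m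
    by auto
  then have "cell_fps {} = 1"
    unfolding cell_fps_def by (intro fps_ext) simp
  then show ?case by simp
next
  case (insert a S)
  have "(\<Prod>a \<in> insert a S. 1 - fps_X ^ weight a) * cell_fps (insert a S) =
      (\<Prod>a \<in> S. 1 - fps_X ^ weight a) * ((1 - fps_X ^ weight a) * cell_fps (insert a S))"
    using insert.hyps by (simp add: ac_simps)
  also have "\<dots> = fps_X ^ weight a * ((\<Prod>a \<in> S. 1 - fps_X ^ weight a) * cell_fps S)"
    unfolding cell_fps_insert[OF insert.hyps] by (simp add: ac_simps)
  also have "\<dots> = fps_X ^ (\<Sum>a \<in> insert a S. weight a)"
    unfolding insert.IH using insert.hyps by (simp add: power_add)
  finally show ?case .
qed

text \<open>The numerator of the series of the cell over the common denominator (1 - q^2)^n. A loop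
  has weight 1, so the total weight is 2d - 1 instead of 2d, and its factor 1/(1 - q) is expanded to
  (1 + q)/(1 - q^2).\<close>

definition cell_poly :: "nat \<Rightarrow> sedge set \<Rightarrow> real poly" where
  "cell_poly n S = (if \<exists>a \<in> S. is_loop a then monom 1 (2 * card S - 1) * [:1, 1:] else monom 1 (2 * card S))
     * [:1, 0, -1:] ^ (n - card S)"

lemma fps_of_poly_1_minus_X2: "fps_of_poly [:1, 0, -1:] = (1 - fps_X\<^sup>2 :: real fps)"
  by (simp add: fps_of_poly_pCons power2_eq_square algebra_simps)

lemma fps_of_poly_cell_poly:
  assumes adm: "admissible n S"
  shows "fps_of_poly (cell_poly n S) = (1 - fps_X\<^sup>2) ^ n * cell_fps S"
proof -
  note fin = admissible_finite[OF adm]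
  define d where "d = card S"
  have split: "(1 - fps_X\<^sup>2 :: real fps) ^ n = (1 - fps_X\<^sup>2) ^ (n - d) * (1 - fps_X\<^sup>2) ^ d"
    using admissible_card[OF adm] by (simp add: d_def flip: power_add)
  show ?thesis
  proof (cases "\<exists>a \<in> S. is_loop a")
    case False
    then have "(\<Prod>a \<in> S. 1 - fps_X ^ weight a :: real fps) = (1 - fps_X\<^sup>2) ^ d"
      "(\<Sum>a \<in> S. weight a) = 2 * d"
      by (simp_all add: weight_def d_def)
    then have "(1 - fps_X\<^sup>2) ^ d * cell_fps S = fps_X ^ (2 * d)" using cell_fps_prod[OF fin] by simp
    then show ?thesis using False
      by (simp add: cell_poly_def split mult.assoc fps_of_poly_mult fps_of_poly_power
          fps_of_poly_1_minus_X2 fps_of_poly_monom flip: d_def)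
  next
    case True
    then obtain a where a: "a \<in> S" "is_loop a" by blast
    define T where "T = S - {a}"
    have S: "S = insert a T" "a \<notin> T" "finite T" using a fin unfolding T_def by auto
    have T: "\<not> is_loop b" if "b \<in> T" for b using admissible_loops[OF adm a] that unfolding T_def by blast
    have cT: "d = Suc (card T)" using S by (simp add: d_def)
    have "(\<Prod>a \<in> S. 1 - fps_X ^ weight a :: real fps) = (1 - fps_X) * (1 - fps_X\<^sup>2) ^ card T"
      "(\<Sum>a \<in> S. weight a) = 2 * card T + 1"
      using S(2,3) T a(2) unfolding S(1) by (simp_all add: weight_def)
    then have *: "(1 - fps_X) * (1 - fps_X\<^sup>2) ^ card T * cell_fps S = fps_X ^ (2 * card T + 1)"
      using cell_fps_prod[OF fin] by simp
    have "(1 - fps_X\<^sup>2 :: real fps) = (1 + fps_X) * (1 - fps_X)" by (simp add: algebra_simps power2_eq_square)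
    then have "(1 - fps_X\<^sup>2) ^ d * cell_fps S = (1 + fps_X) * ((1 - fps_X) * (1 - fps_X\<^sup>2) ^ card T * cell_fps S)"
      unfolding cT by (simp add: mult_ac)
    also have "\<dots> = (1 + fps_X) * fps_X ^ (2 * d - 1)" unfolding * cT by simp
    finally have "(1 - fps_X\<^sup>2) ^ d * cell_fps S = (1 + fps_X) * fps_X ^ (2 * d - 1)" .
    moreover have "fps_of_poly [:1, 1:] = (1 + fps_X :: real fps)"
      by (simp add: fps_of_poly_pCons)
    ultimately show ?thesis using True
      by (simp add: cell_poly_def split mult.assoc fps_of_poly_mult fps_of_poly_power
          fps_of_poly_1_minus_X2 fps_of_poly_monom mult.left_commute mult.commute flip: d_def)
  qed
qed

definition graphs :: "nat \<Rightarrow> sedge set set" where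
  "graphs n = {S. admissible n S \<and> rooted S}"

lemma finite_graphs: "finite (graphs n)"
proof (rule finite_subset)
  show "graphs n \<subseteq> Pow ({1..n} \<times> {1..n} \<times> {Pos, Neg})"
    unfolding graphs_def admissible_def by (fastforce intro: edge_sign.exhaust)
qed simp

definition walk_fps :: "nat \<Rightarrow> real fps" where
  "walk_fps n = Abs_fps (\<lambda>m. real (card {x. walk n x \<and> (\<Sum>v = 1..n. \<bar>x v\<bar>) = int m}))"

definition strict_walk_fps :: "nat \<Rightarrow> real fps" where
  "strict_walk_fps n = Abs_fps (\<lambda>m. real (card {x. strict_walk n x \<and> (\<Sum>v = 1..n. \<bar>x v\<bar>) = int m}))"

lemma strict_walk_imp_walk: "strict_walk n x \<Longrightarrow> walk n x"
  unfolding strict_walk_def walk_def by (metis atLeastatMost_empty_iff not_le order.order_iff_strict order_refl sum.empty less_one)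

lemma strict_walk_fps_cells:
  assumes "1 \<le> n"
  shows "strict_walk_fps n = (\<Sum>S \<in> graphs n. cell_fps S)"
proof (rule fps_ext)
  fix m
  define N where "N S = {M. set_mset M = S \<and> total_weight M = m}" for S
  have "bij_betw mvec (\<Union>S \<in> graphs n. N S) {x. strict_walk n x \<and> (\<Sum>v = 1..n. \<bar>x v\<bar>) = int m}"
    unfolding bij_betw_def
  proof
    show "inj_on mvec (\<Union>S \<in> graphs n. N S)"
      by (rule inj_on_subset[OF inj_on_mvec[of n]]) (auto simp: N_def graphs_def)
    show "mvec ` (\<Union>S \<in> graphs n. N S) = {x. strict_walk n x \<and> (\<Sum>v = 1..n. \<bar>x v\<bar>) = int m}"
    proof (intro equalityI subsetI)
      fix x assume "x \<in> mvec ` (\<Union>S \<in> graphs n. N S)"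
      then obtain M where M: "x = mvec M" "admissible n (set_mset M)" "rooted (set_mset M)" "total_weight M = m"
        unfolding N_def graphs_def by blast
      then show "x \<in> {x. strict_walk n x \<and> (\<Sum>v = 1..n. \<bar>x v\<bar>) = int m}"
        using rooted_iff_strict_walk[OF M(2) assms] mvec_l1[OF M(2)] by simp
    next
      fix x assume x: "x \<in> {x. strict_walk n x \<and> (\<Sum>v = 1..n. \<bar>x v\<bar>) = int m}"
      then obtain M where M: "admissible n (set_mset M)" "mvec M = x"
        using mvec_surj strict_walk_imp_walk by blast
      then have "rooted (set_mset M)" "total_weight M = m"
        using rooted_iff_strict_walk[OF M(1) assms] mvec_l1[OF M(1)] x by simp_all
      then show "x \<in> mvec ` (\<Union>S \<in> graphs n. N S)" using M unfolding N_def graphs_def by blast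
    qed
  qed
  then have "card {x. strict_walk n x \<and> (\<Sum>v = 1..n. \<bar>x v\<bar>) = int m} = card (\<Union>S \<in> graphs n. N S)"
    by (simp add: bij_betw_same_card)
  also have "\<dots> = (\<Sum>S \<in> graphs n. card (N S))"
  proof (rule card_UN_disjoint)
    show "\<forall>S \<in> graphs n. finite (N S)"
    proof
      fix S assume "S \<in> graphs n"
      then have "finite S" using admissible_finite unfolding graphs_def by blast
      from finite_total_weight[OF this, of m] show "finite (N S)"
        unfolding N_def by (rule finite_subset[rotated]) auto
    qed
  qed (auto simp: N_def finite_graphs)
  finally show "fps_nth (strict_walk_fps n) m = fps_nth (\<Sum>S \<in> graphs n. cell_fps S) m"
    by (simp add: strict_walk_fps_def fps_sum_nth cell_fps_def N_def)
qed

lemma strict_walk_fps_shift: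
  assumes "1 \<le> n"
  shows "strict_walk_fps n = fps_X * walk_fps n"
proof (rule fps_ext)
  fix m
  define g where "g x = x(1 := x 1 + 1)" for x :: "nat \<Rightarrow> int"
  have pre: "(\<Sum>v = 1..k. g x v) = (\<Sum>v = 1..k. x v) + (if 1 \<le> k then 1 else 0)" for k x
  proof -
    have "(\<Sum>v = 1..k. g x v) = (\<Sum>v = 1..k. x v + of_bool (v = 1))"
      by (intro sum.cong) (auto simp: g_def)
    then show ?thesis by (auto simp: sum.distrib of_bool_def)
  qed
  \<comment> \<open>The first entry is itself a partial sum. Being nonnegative, it gains exactly 1
    in absolute value when it is increased.\<close>
  have pre1: "0 \<le> x 1" if "walk n x" for x
    using that assms unfolding walk_def by (auto dest: spec[of _ 1])
  have walk_g: "strict_walk n (g x) \<longleftrightarrow> walk n x" for x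
  proof
    assume w: "walk n x"
    show "strict_walk n (g x)" unfolding strict_walk_def pre
      using w assms unfolding walk_def by (auto simp: g_def)
  next
    assume s: "strict_walk n (g x)"
    have "0 \<le> (\<Sum>v = 1..k. x v)" if "k \<le> n" for k
      using s that unfolding strict_walk_def pre by (cases "1 \<le> k") auto
    moreover have "x v = 0" if "v \<notin> {1..n}" for v
    proof -
      have "g x v = 0" using s that unfolding strict_walk_def by blast
      moreover have "v \<noteq> 1" using that assms by auto
      ultimately show ?thesis by (simp add: g_def)
    qed
    ultimately show "walk n x" unfolding walk_def by blast
  qed
  have l1: "(\<Sum>v = 1..n. \<bar>g x v\<bar>) = (\<Sum>v = 1..n. \<bar>x v\<bar>) + 1" if "walk n x" for x
  proof -
    have "(\<Sum>v = 1..n. \<bar>g x v\<bar>) = (\<Sum>v = 1..n. \<bar>x v\<bar> + of_bool (v = 1))"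
      using pre1[OF that] by (intro sum.cong) (auto simp: g_def)
    then show ?thesis using assms by (simp add: sum.distrib of_bool_def)
  qed
  have inj: "inj g"
  proof (rule injI)
    fix x y assume e: "g x = g y"
    show "x = y"
    proof
      fix v show "x v = y v" using fun_cong[OF e, of v] by (auto simp: g_def split: if_splits)
    qed
  qed
  have surj: "\<exists>x. y = g x" for y
    by (rule exI[of _ "y(1 := y 1 - 1)"]) (auto simp: g_def)
  have im: "{x. strict_walk n x \<and> (\<Sum>v = 1..n. \<bar>x v\<bar>) = int m} =
      g ` {x. walk n x \<and> (\<Sum>v = 1..n. \<bar>x v\<bar>) + 1 = int m}"
  proof (intro equalityI subsetI)
    fix y assume y: "y \<in> {x. strict_walk n x \<and> (\<Sum>v = 1..n. \<bar>x v\<bar>) = int m}"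
    obtain x where x: "y = g x" using surj by blast
    then show "y \<in> g ` {x. walk n x \<and> (\<Sum>v = 1..n. \<bar>x v\<bar>) + 1 = int m}"
      using y walk_g[of x] l1[of x] by auto
  qed (use walk_g l1 in auto)
  have "card {x. strict_walk n x \<and> (\<Sum>v = 1..n. \<bar>x v\<bar>) = int m} =
      (if m = 0 then 0 else card {x. walk n x \<and> (\<Sum>v = 1..n. \<bar>x v\<bar>) = int (m - 1)})"
  proof (cases m)
    case 0
    have "(\<Sum>v = 1..n. \<bar>x v\<bar>) + 1 \<noteq> int m" for x :: "nat \<Rightarrow> int"
      using sum_nonneg[of "{1..n}" "\<lambda>v. \<bar>x v\<bar>"] 0 by linarith
    then have none: "{x. walk n x \<and> (\<Sum>v = 1..n. \<bar>x v\<bar>) + 1 = int m} = {}" by blast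
    show ?thesis unfolding im none using 0 by simp
  next
    case (Suc m')
    have "{x. walk n x \<and> (\<Sum>v = 1..n. \<bar>x v\<bar>) + 1 = int m} = {x. walk n x \<and> (\<Sum>v = 1..n. \<bar>x v\<bar>) = int (m - 1)}"
      using Suc by auto
    then show ?thesis using im Suc inj by (simp add: card_image inj_on_subset[OF inj])
  qed
  then show "fps_nth (strict_walk_fps n) m = fps_nth (fps_X * walk_fps n) m"
    by (simp add: strict_walk_fps_def walk_fps_def)
qed

section \<open>Walks as lists and the cut at the last minimal partial sum\<close>

definition l1_lists :: "nat \<Rightarrow> nat \<Rightarrow> int list set" where
  "l1_lists n m = {xs. length xs = n \<and> (\<Sum>x \<leftarrow> xs. \<bar>x\<bar>) = int m}"

definition walk_lists :: "nat \<Rightarrow> nat \<Rightarrow> int list set" where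
  "walk_lists n m = {xs \<in> l1_lists n m. \<forall>k \<le> n. 0 \<le> sum_list (take k xs)}"

definition strict_walk_lists :: "nat \<Rightarrow> nat \<Rightarrow> int list set" where
  "strict_walk_lists n m = {xs \<in> l1_lists n m. \<forall>k. 1 \<le> k \<and> k \<le> n \<longrightarrow> 0 < sum_list (take k xs)}"

definition fun_of_list :: "nat \<Rightarrow> int list \<Rightarrow> nat \<Rightarrow> int" where
  "fun_of_list n xs v = (if v \<in> {1..n} then xs ! (v - 1) else 0)"

lemma fun_of_list_prefix:
  assumes "length xs = n" "k \<le> n"
  shows "(\<Sum>v = 1..k. h (fun_of_list n xs v)) = (\<Sum>x \<leftarrow> take k xs. (h x :: int))"
proof -
  have "(\<Sum>x \<leftarrow> take k xs. h x) = (\<Sum>i = 0..<k. h (xs ! i))"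
    using assms by (simp add: sum_list_sum_nth min_def)
  also have "\<dots> = (\<Sum>v = 1..k. h (xs ! (v - 1)))"
    by (rule sum.reindex_bij_witness[of _ "\<lambda>v. v - 1" Suc]) auto
  also have "\<dots> = (\<Sum>v = 1..k. h (fun_of_list n xs v))"
    using assms(2) by (intro sum.cong) (auto simp: fun_of_list_def)
  finally show ?thesis by simp
qed

lemma inj_on_fun_of_list: "inj_on (fun_of_list n) {xs. length xs = n}"
proof (rule inj_onI)
  fix xs ys assume xy: "xs \<in> {xs. length xs = n}" "ys \<in> {xs. length xs = n}"
    "fun_of_list n xs = fun_of_list n ys"
  show "xs = ys"
  proof (rule nth_equalityI)
    fix i assume "i < length xs"
    then show "xs ! i = ys ! i" using fun_cong[OF xy(3), of "Suc i"] xy(1) by (simp add: fun_of_list_def)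
  qed (use xy in simp)
qed

lemma fun_of_list_surj:
  assumes "\<forall>v. v \<notin> {1..n} \<longrightarrow> x v = 0"
  obtains xs where "length xs = n" "x = fun_of_list n xs"
proof
  show "length (map x [1..<Suc n]) = n" by simp
  show "x = fun_of_list n (map x [1..<Suc n])"
    using assms by (auto simp: fun_of_list_def fun_eq_iff simp del: upt_Suc)
qed

lemma card_fun_of_list:
  assumes "\<And>x. P x \<Longrightarrow> \<forall>v. v \<notin> {1..n} \<longrightarrow> x v = 0"
    and "\<And>xs. length xs = n \<Longrightarrow> P (fun_of_list n xs) \<longleftrightarrow> xs \<in> A"
    and "\<And>xs. xs \<in> A \<Longrightarrow> length xs = n"
  shows "card {x. P x} = card A"
proof -
  have "{x. P x} = fun_of_list n ` A"
  proof (intro equalityI subsetI)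
    fix x assume x: "x \<in> {x. P x}"
    then obtain xs where "length xs = n" "x = fun_of_list n xs"
      using fun_of_list_surj assms(1) by (metis mem_Collect_eq)
    then show "x \<in> fun_of_list n ` A" using x assms(2) by blast
  qed (use assms(2,3) in auto)
  moreover have "inj_on (fun_of_list n) A"
    using inj_on_fun_of_list by (rule inj_on_subset) (use assms(3) in auto)
  ultimately show ?thesis by (simp add: card_image)
qed

lemma walk_fps_lists: "walk_fps n = Abs_fps (\<lambda>m. real (card (walk_lists n m)))"
proof -
  have "card {x. walk n x \<and> (\<Sum>v = 1..n. \<bar>x v\<bar>) = int m} = card (walk_lists n m)" for m
  proof (rule card_fun_of_list)
    fix xs :: "int list" assume l: "length xs = n"
    have "(\<Sum>v = 1..k. fun_of_list n xs v) = sum_list (take k xs)" if "k \<le> n" for k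
      using fun_of_list_prefix[OF l that, of "\<lambda>x. x"] by simp
    then show "(walk n (fun_of_list n xs) \<and> (\<Sum>v = 1..n. \<bar>fun_of_list n xs v\<bar>) = int m) = (xs \<in> walk_lists n m)"
      using fun_of_list_prefix[OF l le_refl, of abs] l
      by (auto simp: walk_def walk_lists_def l1_lists_def fun_of_list_def)
  qed (auto simp: walk_def walk_lists_def l1_lists_def)
  then show ?thesis unfolding walk_fps_def by simp
qed

lemma strict_walk_fps_lists: "strict_walk_fps n = Abs_fps (\<lambda>m. real (card (strict_walk_lists n m)))"
proof -
  have "card {x. strict_walk n x \<and> (\<Sum>v = 1..n. \<bar>x v\<bar>) = int m} = card (strict_walk_lists n m)" for m
  proof (rule card_fun_of_list)
    fix xs :: "int list" assume l: "length xs = n"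
    have "(\<Sum>v = 1..k. fun_of_list n xs v) = sum_list (take k xs)" if "k \<le> n" for k
      using fun_of_list_prefix[OF l that, of "\<lambda>x. x"] by simp
    then show "(strict_walk n (fun_of_list n xs) \<and> (\<Sum>v = 1..n. \<bar>fun_of_list n xs v\<bar>) = int m) =
        (xs \<in> strict_walk_lists n m)"
      using fun_of_list_prefix[OF l le_refl, of abs] l
      by (auto simp: strict_walk_def strict_walk_lists_def l1_lists_def fun_of_list_def)
  qed (auto simp: strict_walk_def strict_walk_lists_def l1_lists_def)
  then show ?thesis unfolding strict_walk_fps_def by simp
qed

lemma sum_list_abs_nonneg: "0 \<le> (\<Sum>x \<leftarrow> xs. \<bar>x :: int\<bar>)"
  by (induction xs) auto

lemma l1_lists_0: "l1_lists 0 m = (if m = 0 then {[]} else {})"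
  by (auto simp: l1_lists_def)

lemma l1_lists_Suc:
  "l1_lists (Suc n) m = (\<lambda>(j, x, xs). x # xs) ` (SIGMA j:{..m}. {x. \<bar>x\<bar> = int j} \<times> l1_lists n (m - j))"
proof (intro equalityI subsetI)
  fix ys assume "ys \<in> l1_lists (Suc n) m"
  then obtain x xs where ys: "ys = x # xs" "length xs = n" "\<bar>x\<bar> + (\<Sum>x \<leftarrow> xs. \<bar>x\<bar>) = int m"
    unfolding l1_lists_def by (cases ys) auto
  define j where "j = nat \<bar>x\<bar>"
  have "j \<le> m" "\<bar>x\<bar> = int j" using ys(3) sum_list_abs_nonneg[of xs] unfolding j_def by linarith+
  then have "(j, x, xs) \<in> (SIGMA j:{..m}. {x. \<bar>x\<bar> = int j} \<times> l1_lists n (m - j))"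
    using ys by (auto simp: l1_lists_def)
  then show "ys \<in> (\<lambda>(j, x, xs). x # xs) ` (SIGMA j:{..m}. {x. \<bar>x\<bar> = int j} \<times> l1_lists n (m - j))"
    unfolding ys(1) by (rule rev_image_eqI) simp
qed (auto simp: l1_lists_def)

lemma abs_eq_int: "{x :: int. \<bar>x\<bar> = int j} = {int j, - int j}"
  by auto

lemma finite_l1_lists: "finite (l1_lists n m)"
proof (induction n arbitrary: m)
  case (Suc n)
  then show ?case unfolding l1_lists_Suc abs_eq_int by (intro finite_imageI finite_SigmaI) auto
qed (simp add: l1_lists_0)

lemma l1_lists_fps:
  "Abs_fps (\<lambda>m. real (card (l1_lists n m))) * (1 - fps_X) ^ n = (1 + fps_X) ^ n"
proof (induction n)
  case 0
  have "Abs_fps (\<lambda>m. real (card (l1_lists 0 m))) = 1" by (intro fps_ext) (simp add: l1_lists_0)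
  then show ?case by simp
next
  case (Suc n)
  define K where "K = Abs_fps (\<lambda>j. real (card {x :: int. \<bar>x\<bar> = int j}))"
  have K: "K * (1 - fps_X) = 1 + fps_X"
  proof (rule fps_ext)
    fix j
    have "card {int j, - int j} = (if j = 0 then 1 else 2)" for j by (simp add: card_insert_if)
    then show "fps_nth (K * (1 - fps_X)) j = fps_nth (1 + fps_X) j"
      unfolding K_def abs_eq_int by (simp add: right_diff_distrib fps_X_nth split: if_splits)
  qed
  have "Abs_fps (\<lambda>m. real (card (l1_lists (Suc n) m))) = K * Abs_fps (\<lambda>m. real (card (l1_lists n m)))"
  proof (rule fps_ext)
    fix m
    have "inj_on (\<lambda>(j, x, xs). x # xs) (SIGMA j:{..m}. {x. \<bar>x\<bar> = int j} \<times> l1_lists n (m - j))"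
      by (auto simp: inj_on_def)
    then have "card (l1_lists (Suc n) m) = (\<Sum>j \<le> m. card {x :: int. \<bar>x\<bar> = int j} * card (l1_lists n (m - j)))"
      unfolding l1_lists_Suc
      by (subst card_image, assumption, subst card_SigmaI)
        (auto simp: abs_eq_int finite_l1_lists card_cartesian_product intro!: finite_cartesian_product)
    then show "fps_nth (Abs_fps (\<lambda>m. real (card (l1_lists (Suc n) m)))) m =
        fps_nth (K * Abs_fps (\<lambda>m. real (card (l1_lists n m)))) m"
      by (simp add: fps_mult_nth K_def atLeast0AtMost)
  qed
  then have "Abs_fps (\<lambda>m. real (card (l1_lists (Suc n) m))) * (1 - fps_X) ^ Suc n =
      (K * (1 - fps_X)) * (Abs_fps (\<lambda>m. real (card (l1_lists n m))) * (1 - fps_X) ^ n)"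
    by (simp add: mult_ac)
  then show ?case unfolding K Suc.IH by simp
qed

text \<open>The suffix sums of ys say that the partial sum at the cut is minimal, the prefix sums of
  zs that it is the last minimum. Prepending x shifts all old partial sums equally and adds the
  empty one, so the cut either stays where it is or moves to the front.\<close>

lemma last_minimum_exists:
  fixes xs :: "int list"
  shows "\<exists>ys zs. xs = ys @ zs \<and> (\<forall>k \<le> length ys. sum_list (drop k ys) \<le> 0) \<and>
    (\<forall>k. 1 \<le> k \<and> k \<le> length zs \<longrightarrow> 0 < sum_list (take k zs))"
proof (induction xs)
  case (Cons x xs)
  then obtain ys zs where xs: "xs = ys @ zs"
    and ys: "\<And>k. k \<le> length ys \<Longrightarrow> sum_list (drop k ys) \<le> 0"
    and zs: "\<And>k. 1 \<le> k \<Longrightarrow> k \<le> length zs \<Longrightarrow> 0 < sum_list (take k zs)" by blast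
  show ?case
  proof (cases "x + sum_list ys \<le> 0")
    case True
    have "sum_list (drop k (x # ys)) \<le> 0" if "k \<le> length (x # ys)" for k
      using that True ys by (cases k) auto
    then show ?thesis using xs zs by (intro exI[of _ "x # ys"] exI[of _ zs]) auto
  next
    case False
    have "0 < sum_list (take k (x # xs))" if k: "1 \<le> k" "k \<le> length (x # xs)" for k
    proof -
      obtain k' where k': "k = Suc k'" using k(1) by (cases k) auto
      show ?thesis
      proof (cases "k' \<le> length ys")
        case True
        have "sum_list ys = sum_list (take k' ys) + sum_list (drop k' ys)"
          by (metis append_take_drop_id sum_list_append)
        then show ?thesis using ys[OF True] False True by (simp add: k' xs)
      next
        case F: False
        have "0 < sum_list (take (k' - length ys) zs)" using F k(2) by (intro zs) (simp_all add: k' xs)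
        then show ?thesis using F False by (simp add: k' xs)
      qed
    qed
    then show ?thesis by (intro exI[of _ "[]"] exI[of _ "x # xs"]) auto
  qed
qed simp

text \<open>If ys' were longer, the piece d between the two cuts would be a suffix of ys' and a
  prefix of zs, so that its sum would be both nonpositive and positive.\<close>

lemma last_minimum_unique:
  fixes ys zs ys' zs' :: "int list"
  assumes "ys @ zs = ys' @ zs'"
    and "\<forall>k \<le> length ys'. sum_list (drop k ys') \<le> 0"
    and "\<forall>k. 1 \<le> k \<and> k \<le> length zs \<longrightarrow> 0 < sum_list (take k zs)"
  shows "length ys' \<le> length ys"
proof (rule ccontr)
  assume "\<not> ?thesis"
  then obtain d where d: "ys' = ys @ d" "zs = d @ zs'" "d \<noteq> []"
    using assms(1) by (auto simp: append_eq_append_conv2)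
  have "sum_list d \<le> 0" using assms(2)[rule_format, of "length ys"] d by simp
  moreover have "0 < sum_list d"
    using assms(3)[rule_format, of "length d"] d by (simp add: Suc_le_eq)
  ultimately show False by simp
qed

text \<open>Cut a sequence after its last minimal partial sum: the part before, reversed and negated,
  has nonnegative partial sums, and the part after has positive ones.\<close>

lemma l1_lists_split:
  "card (l1_lists n m) =
   (\<Sum>k \<le> n. \<Sum>j \<le> m. card (walk_lists k j) * card (strict_walk_lists (n - k) (m - j)))"
proof -
  define I where "I = (SIGMA k:{..n}. SIGMA j:{..m}. walk_lists k j \<times> strict_walk_lists (n - k) (m - j))"
  define g :: "nat \<times> nat \<times> int list \<times> int list \<Rightarrow> int list" where
    "g = (\<lambda>(k, j, ys, zs). map uminus (rev ys) @ zs)"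
  have sum_uminus: "sum_list (map uminus ys) = - sum_list ys" for ys :: "int list"
    by (induction ys) auto
  have abs_rev: "(\<Sum>x \<leftarrow> map uminus (rev ys). \<bar>x\<bar>) = (\<Sum>x \<leftarrow> ys. \<bar>x\<bar>)" for ys :: "int list"
    by (induction ys) auto
  have drop_rev: "sum_list (drop k (map uminus (rev ys))) = - sum_list (take (length ys - k) ys)"
    for k and ys :: "int list"
    by (simp add: drop_map drop_rev take_map sum_uminus flip: rev_map)
  have suffix: "\<forall>i \<le> length (map uminus (rev ys)). sum_list (drop i (map uminus (rev ys))) \<le> 0"
    if "ys \<in> walk_lists k j" for k j ys
    using that unfolding drop_rev walk_lists_def l1_lists_def by auto
  have len: "length ys = k" "length zs = n - k" if "(k, j, ys, zs) \<in> I" for k j ys zs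
    using that unfolding I_def walk_lists_def strict_walk_lists_def l1_lists_def by auto
  have inj: "inj_on g I"
  proof (rule inj_onI)
    fix a b assume ab: "a \<in> I" "b \<in> I" "g a = g b"
    obtain k j ys zs k' j' ys' zs' where e: "a = (k, j, ys, zs)" "b = (k', j', ys', zs')"
      by (metis prod_cases4)
    have m: "ys \<in> walk_lists k j" "zs \<in> strict_walk_lists (n - k) (m - j)"
      "ys' \<in> walk_lists k' j'" "zs' \<in> strict_walk_lists (n - k') (m - j')"
      using ab(1,2) unfolding I_def e by auto
    have z: "\<forall>i. 1 \<le> i \<and> i \<le> length zs \<longrightarrow> 0 < sum_list (take i zs)"
      "\<forall>i. 1 \<le> i \<and> i \<le> length zs' \<longrightarrow> 0 < sum_list (take i zs')"
      using m(2,4) unfolding strict_walk_lists_def l1_lists_def by auto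
    have eq: "map uminus (rev ys) @ zs = map uminus (rev ys') @ zs'" using ab(3) by (simp add: g_def e)
    \<comment> \<open>The comparison of the two cuts, applied in both directions.\<close>
    have "length (map uminus (rev ys)) = length (map uminus (rev ys'))"
      using last_minimum_unique[OF eq suffix[OF m(3)] z(1)]
        last_minimum_unique[OF eq[symmetric] suffix[OF m(1)] z(2)] by simp
    then have "map uminus (rev ys) = map uminus (rev ys')" "zs = zs'" using eq by auto
    then have "ys = ys'" by (metis inj_map_eq_map inj_uminus rev_is_rev_conv)
    moreover have "k = k'" "j = j'"
      using \<open>ys = ys'\<close> m unfolding walk_lists_def l1_lists_def by auto
    ultimately show "a = b" using \<open>zs = zs'\<close> e by simp
  qed
  have "g ` I = l1_lists n m"
  proof (intro equalityI subsetI)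
    fix xs assume "xs \<in> g ` I"
    then obtain k j ys zs where k: "(k, j, ys, zs) \<in> I" "xs = map uminus (rev ys) @ zs"
      unfolding g_def by auto
    then have "k \<le> n" "j \<le> m" "(\<Sum>x \<leftarrow> ys. \<bar>x\<bar>) = int j" "(\<Sum>x \<leftarrow> zs. \<bar>x\<bar>) = int (m - j)"
      unfolding I_def walk_lists_def strict_walk_lists_def l1_lists_def by auto
    then show "xs \<in> l1_lists n m"
      using len[OF k(1)] abs_rev[of ys] unfolding l1_lists_def k(2) map_append sum_list_append by auto
  next
    fix xs assume xs: "xs \<in> l1_lists n m"
    obtain us zs where us: "xs = us @ zs" "\<forall>k \<le> length us. sum_list (drop k us) \<le> 0"
      "\<forall>k. 1 \<le> k \<and> k \<le> length zs \<longrightarrow> 0 < sum_list (take k zs)"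
      using last_minimum_exists by blast
    define ys where "ys = map uminus (rev us)"
    have us': "us = map uminus (rev ys)" by (simp add: ys_def rev_map o_def)
    define k where "k = length us"
    define j where "j = nat (\<Sum>x \<leftarrow> us. \<bar>x\<bar>)"
    have j: "int j = (\<Sum>x \<leftarrow> us. \<bar>x\<bar>)" unfolding j_def using sum_list_abs_nonneg by simp
    have tot: "(\<Sum>x \<leftarrow> us. \<bar>x\<bar>) + (\<Sum>x \<leftarrow> zs. \<bar>x\<bar>) = int m" and ln: "k + length zs = n"
      using xs unfolding us(1) l1_lists_def k_def by auto
    have "j \<le> m" "k \<le> n" using tot sum_list_abs_nonneg[of zs] j ln by linarith+
    have "0 \<le> sum_list (take i ys)" if "i \<le> k" for i
    proof -
      have "sum_list (drop (k - i) us) = - sum_list (take i ys)"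
        unfolding us' drop_rev using that by (simp add: k_def us')
      moreover have "sum_list (drop (k - i) us) \<le> 0" using us(2) by (simp add: k_def)
      ultimately show ?thesis by simp
    qed
    then have "ys \<in> walk_lists k j"
      using j abs_rev[of ys] us' unfolding walk_lists_def l1_lists_def by (auto simp: k_def)
    moreover have "zs \<in> strict_walk_lists (n - k) (m - j)"
      using us(3) tot ln j \<open>j \<le> m\<close> unfolding strict_walk_lists_def l1_lists_def by auto
    ultimately have "(k, j, ys, zs) \<in> I" unfolding I_def using \<open>j \<le> m\<close> \<open>k \<le> n\<close> by simp
    then show "xs \<in> g ` I" by (rule rev_image_eqI) (simp add: g_def us(1) us')
  qed
  then have "card (l1_lists n m) = card I" using inj by (metis card_image)
  also have "\<dots> = (\<Sum>k \<le> n. \<Sum>j \<le> m. card (walk_lists k j) * card (strict_walk_lists (n - k) (m - j)))"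
  proof -
    have f: "finite (walk_lists k j)" "finite (strict_walk_lists k j)" for k j
      using finite_l1_lists[of k j] unfolding walk_lists_def strict_walk_lists_def by auto
    show ?thesis unfolding I_def
      by (subst card_SigmaI, simp, use f in blast, subst card_SigmaI) (auto simp: f card_cartesian_product)
  qed
  finally show ?thesis .
qed

lemma walk_fps_convolution:
  "(\<Sum>k \<le> n. walk_fps k * strict_walk_fps (n - k)) * (1 - fps_X) ^ n = (1 + fps_X) ^ n"
proof -
  have "(\<Sum>k \<le> n. walk_fps k * strict_walk_fps (n - k)) = Abs_fps (\<lambda>m. real (card (l1_lists n m)))"
    by (rule fps_ext) (simp add: fps_sum_nth fps_mult_nth walk_fps_lists strict_walk_fps_lists
        l1_lists_split atLeast0AtMost)
  then show ?thesis by (simp add: l1_lists_fps)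
qed

subsection \<open>Reciprocity\<close>

definition graph_poly :: "nat \<Rightarrow> real poly" where
  "graph_poly n = (\<Sum>S \<in> graphs n. cell_poly n S)"

text \<open>The reversal q^(2n) p(1/q) of \<open>cell_poly\<close>: q^(2d) cancels the monomial and
  turns the numerator of a loop into 1 + q, while each of the n - d factors 1 - q^(-2) times q^2 is
  -(1 - q^2). Divided by (1 - q^2)^n it is, up to sign, the series of the closed cone, in which
  edges may have multiplicity 0.\<close>

definition dual_cell_poly :: "nat \<Rightarrow> sedge set \<Rightarrow> real poly" where
  "dual_cell_poly n S = (-1) ^ (n - card S) *
     ((if \<exists>a \<in> S. is_loop a then [:1, 1:] else 1) * [:1, 0, -1:] ^ (n - card S))"

lemma fps_of_poly_graph_poly:
  assumes "1 \<le> n"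
  shows "fps_of_poly (graph_poly n) = (1 - fps_X\<^sup>2) ^ n * strict_walk_fps n"
  unfolding graph_poly_def strict_walk_fps_cells[OF assms] fps_of_poly_sum sum_distrib_left
  by (intro sum.cong) (auto simp: graphs_def fps_of_poly_cell_poly)

lemma walk_fps_0: "walk_fps 0 = 1" "strict_walk_fps 0 = 1"
proof -
  have "walk_lists 0 m = l1_lists 0 m" "strict_walk_lists 0 m = l1_lists 0 m" for m
    unfolding walk_lists_def strict_walk_lists_def by (auto simp: l1_lists_def)
  then show "walk_fps 0 = 1" "strict_walk_fps 0 = 1"
    unfolding walk_fps_lists strict_walk_fps_lists by (auto intro!: fps_ext simp: l1_lists_0)
qed

text \<open>The convolution times q (1 - q^2)^n, with W_k eliminated by q W_k = S_k for k \<ge> 1.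
  The terms k = 0 and k = n combine to (1 + q) S_n. On the right, the denominator (1 - q)^n cancels
  against (1 - q^2)^n. What remains is an identity of polynomials, in which 1/q may be
  substituted.\<close>

lemma graph_poly_recursion:
  assumes "1 \<le> n"
  shows "[:1, 1:] * graph_poly n + (\<Sum>k = 1..<n. graph_poly k * graph_poly (n - k)) =
    [:0, 1:] * [:1, 1:] ^ (2 * n)"
proof -
  define S where "S = strict_walk_fps"
  define W where "W = walk_fps"
  define Q :: "real fps" where "Q = 1 - fps_X\<^sup>2"
  have Q: "Q = (1 + fps_X) * (1 - fps_X)" by (simp add: Q_def algebra_simps power2_eq_square)
  have lin: "fps_of_poly [:1, 1:] = (1 + fps_X :: real fps)" by (simp add: fps_of_poly_pCons)
  have "{..n} = insert 0 (insert n {1..<n})" using assms by auto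
  then have "(\<Sum>k \<le> n. W k * S (n - k)) = S n + W n + (\<Sum>k = 1..<n. W k * S (n - k))"
    using assms by (simp add: W_def S_def walk_fps_0)
  then have "fps_X * (\<Sum>k \<le> n. W k * S (n - k)) =
      fps_X * S n + fps_X * W n + (\<Sum>k = 1..<n. (fps_X * W k) * S (n - k))"
    by (simp add: algebra_simps sum_distrib_left)
  also have "\<dots> = (1 + fps_X) * S n + (\<Sum>k = 1..<n. S k * S (n - k))"
    using strict_walk_fps_shift assms by (simp add: S_def W_def algebra_simps)
  finally have "Q ^ n * (fps_X * (\<Sum>k \<le> n. W k * S (n - k))) =
      (1 + fps_X) * (Q ^ n * S n) + (\<Sum>k = 1..<n. Q ^ n * (S k * S (n - k)))"
    by (simp add: algebra_simps sum_distrib_left)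
  also have "(\<Sum>k = 1..<n. Q ^ n * (S k * S (n - k))) = (\<Sum>k = 1..<n. (Q ^ k * S k) * (Q ^ (n - k) * S (n - k)))"
  proof (intro sum.cong refl)
    fix k assume "k \<in> {1..<n}"
    then have "Q ^ n = Q ^ k * Q ^ (n - k)" by (simp flip: power_add)
    then show "Q ^ n * (S k * S (n - k)) = (Q ^ k * S k) * (Q ^ (n - k) * S (n - k))" by (simp add: mult_ac)
  qed
  also have "(1 + fps_X) * (Q ^ n * S n) + (\<Sum>k = 1..<n. (Q ^ k * S k) * (Q ^ (n - k) * S (n - k))) =
      fps_of_poly ([:1, 1:] * graph_poly n + (\<Sum>k = 1..<n. graph_poly k * graph_poly (n - k)))"
    unfolding fps_of_poly_add fps_of_poly_mult fps_of_poly_sum lin Q_def S_def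
    by (intro arg_cong2[where f = "(+)"] arg_cong2[where f = "(*)"] sum.cong refl)
      (use fps_of_poly_graph_poly assms in auto)
  also have "Q ^ n * (fps_X * (\<Sum>k \<le> n. W k * S (n - k))) =
      fps_X * (1 + fps_X) ^ n * ((\<Sum>k \<le> n. W k * S (n - k)) * (1 - fps_X) ^ n)"
    unfolding Q power_mult_distrib by (simp only: mult_ac)
  also have "\<dots> = fps_X * (1 + fps_X) ^ (2 * n)"
    unfolding W_def S_def walk_fps_convolution by (simp add: mult_2 power_add mult.assoc)
  also have "\<dots> = fps_of_poly ([:0, 1:] * [:1, 1:] ^ (2 * n))"
    by (simp add: fps_of_poly_mult fps_of_poly_power lin)
  finally show ?thesis unfolding fps_of_poly_eq_iff by (rule sym)
qed

text \<open>The recursion is invariant under reversal: after 1/q is put for q, multiplication by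
  q^(2n+2) restores the right-hand side, and the exponents (2k + 1) + (2(n - k) + 1) = 2n + 2 fit
  the products. With the earlier polynomials palindromic by induction, dividing by 1 + q gives the
  claim for n.\<close>

lemma graph_poly_palindromic:
  fixes q :: real
  assumes "0 < q"
  shows "1 \<le> n \<Longrightarrow> q ^ (2 * n + 1) * poly (graph_poly n) (1 / q) = poly (graph_poly n) q"
proof (induction n rule: less_induct)
  case (less n)
  define p where "p k x = poly (graph_poly k) x" for k and x :: real
  have rec: "(1 + x) * p n x + (\<Sum>k = 1..<n. p k x * p (n - k) x) = x * (1 + x) ^ (2 * n)" for x
    using arg_cong[OF graph_poly_recursion[OF less.prems], of "\<lambda>f. poly f x"]
    by (simp add: p_def poly_sum distrib_right)
  have "q ^ (2 * n + 2) * (p k (1 / q) * p (n - k) (1 / q)) = p k q * p (n - k) q" if k: "k \<in> {1..<n}" for k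
  proof -
    have "2 * n + 2 = (2 * k + 1) + (2 * (n - k) + 1)" using k by auto
    then have "q ^ (2 * n + 2) = q ^ (2 * k + 1) * q ^ (2 * (n - k) + 1)"
      unfolding power_add[symmetric] by (rule arg_cong)
    then have "q ^ (2 * n + 2) * (p k (1 / q) * p (n - k) (1 / q)) =
        (q ^ (2 * k + 1) * p k (1 / q)) * (q ^ (2 * (n - k) + 1) * p (n - k) (1 / q))"
      by (simp only: mult_ac)
    also have "q ^ (2 * k + 1) * p k (1 / q) = p k q" using less.IH[of k] k unfolding p_def by auto
    also have "q ^ (2 * (n - k) + 1) * p (n - k) (1 / q) = p (n - k) q"
      using less.IH[of "n - k"] k unfolding p_def by auto
    finally show ?thesis .
  qed
  then have sums: "q ^ (2 * n + 2) * (\<Sum>k = 1..<n. p k (1 / q) * p (n - k) (1 / q)) = (\<Sum>k = 1..<n. p k q * p (n - k) q)"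
    unfolding sum_distrib_left by (intro sum.cong) auto
  have lin: "q * (1 + 1 / q) = 1 + q" using assms by (simp add: field_simps)
  have "q ^ (2 * n + 2) * (1 / q * (1 + 1 / q) ^ (2 * n)) = q * (q * (1 + 1 / q)) ^ (2 * n)"
    using assms by (simp add: power_mult_distrib)
  also have "\<dots> = q * (1 + q) ^ (2 * n)" unfolding lin ..
  also have "\<dots> = (1 + q) * p n q + q ^ (2 * n + 2) * (\<Sum>k = 1..<n. p k (1 / q) * p (n - k) (1 / q))"
    unfolding sums using rec[of q] by simp
  finally have "q ^ (2 * n + 2) * ((1 + 1 / q) * p n (1 / q)) = (1 + q) * p n q"
    using arg_cong[OF rec[of "1 / q"], of "\<lambda>x. q ^ (2 * n + 2) * x"] by (simp only: distrib_left)
  moreover have "q ^ (2 * n + 2) * ((1 + 1 / q) * p n (1 / q)) = (1 + q) * (q ^ (2 * n + 1) * p n (1 / q))"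
    unfolding lin[symmetric] by (simp add: mult_ac)
  ultimately show ?case using assms by (simp add: p_def)
qed

lemma cell_poly_reciprocal:
  fixes q :: real
  assumes adm: "admissible n S" and q: "0 < q"
  shows "q ^ (2 * n) * poly (cell_poly n S) (1 / q) = poly (dual_cell_poly n S) q"
proof -
  define d where "d = card S"
  have d: "d \<le> n" using admissible_card[OF adm] by (simp add: d_def)
  have pow: "q ^ (2 * n) = q ^ (2 * d) * (q\<^sup>2) ^ (n - d)"
  proof -
    have "2 * n = 2 * d + 2 * (n - d)" using d by simp
    then have "q ^ (2 * n) = q ^ (2 * d + 2 * (n - d))" by (rule arg_cong)
    then show ?thesis by (simp only: power_add power_mult)
  qed
  have "(q\<^sup>2) ^ (n - d) * (1 - (1 / q) * (1 / q)) ^ (n - d) = (q\<^sup>2 * (1 - (1 / q) * (1 / q))) ^ (n - d)"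
    by (simp only: power_mult_distrib)
  also have "q\<^sup>2 * (1 - (1 / q) * (1 / q)) = - 1 * (1 - q * q)"
    using q by (simp add: field_simps power2_eq_square)
  finally have base: "(q\<^sup>2) ^ (n - d) * (1 - (1 / q) * (1 / q)) ^ (n - d) = (- 1) ^ (n - d) * (1 - q * q) ^ (n - d)"
    by (simp only: power_mult_distrib)
  define c where "c x = (if \<exists>a \<in> S. is_loop a then x ^ (2 * d - 1) * (1 + x) else x ^ (2 * d))" for x :: real
  have c: "q ^ (2 * d) * c (1 / q) = (if \<exists>a \<in> S. is_loop a then 1 + q else 1)"
  proof (cases "\<exists>a \<in> S. is_loop a")
    case True
    then have "d \<noteq> 0" using admissible_finite[OF adm] by (auto simp: d_def)
    then obtain d' where "2 * d = Suc d'" by (cases d) auto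
    then show ?thesis using True q by (simp add: c_def field_simps)
  next
    case False then show ?thesis using q by (simp add: c_def power_one_over)
  qed
  have "poly (cell_poly n S) (1 / q) = c (1 / q) * (1 - (1 / q) * (1 / q)) ^ (n - d)"
    by (cases "\<exists>a \<in> S. is_loop a") (simp_all add: cell_poly_def c_def poly_monom d_def distrib_left)
  then have "q ^ (2 * n) * poly (cell_poly n S) (1 / q) =
      (q ^ (2 * d) * c (1 / q)) * ((q\<^sup>2) ^ (n - d) * (1 - (1 / q) * (1 / q)) ^ (n - d))"
    unfolding pow by (simp only: mult_ac)
  then show ?thesis unfolding c base
    by (simp add: dual_cell_poly_def d_def mult_ac)
qed

text \<open>The whole sum is palindromic, while reversing it cell by cell produces the dual
  polynomials. The two agree at every positive real, hence as polynomials. The extra factor q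
  accounts for the difference between the exponents 2n + 1 and 2n.\<close>

lemma graph_poly_dual:
  assumes "1 \<le> n"
  shows "graph_poly n = [:0, 1:] * (\<Sum>S \<in> graphs n. dual_cell_poly n S)" (is "_ = ?r")
proof -
  have "poly (graph_poly n - ?r) q = 0" if q: "q > 0" for q :: real
  proof -
    have "poly (graph_poly n) q = q * (q ^ (2 * n) * poly (graph_poly n) (1 / q))"
      using graph_poly_palindromic[OF q assms] by (simp add: mult_ac)
    also have "q ^ (2 * n) * poly (graph_poly n) (1 / q) = (\<Sum>S \<in> graphs n. poly (dual_cell_poly n S) q)"
      unfolding graph_poly_def poly_sum sum_distrib_left
      by (intro sum.cong refl cell_poly_reciprocal[OF _ q]) (simp add: graphs_def)
    finally show ?thesis by (simp add: poly_sum)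
  qed
  then have "{0<..} \<subseteq> {q. poly (graph_poly n - ?r) q = 0}" by auto
  then have "infinite {q. poly (graph_poly n - ?r) q = 0}"
    using infinite_Ioi finite_subset by blast
  then have "graph_poly n - ?r = 0" using poly_roots_finite by blast
  then show ?thesis by simp
qed

section \<open>Extraction of coefficients\<close>

definition binomial_fps :: "nat \<Rightarrow> real fps" where
  "binomial_fps d = Abs_fps (\<lambda>m. if even m then real ((d + m div 2) choose d) else 0)"

text \<open>Pascal's rule gives the induction step. The binomials are thus the expansion of 1/(1 -
  q^2)^(d+1).\<close>

lemma binomial_fps_power: "(1 - fps_X\<^sup>2) ^ Suc d * binomial_fps d = 1"
proof (induction d)
  case 0
  show ?case
    by (rule fps_ext) (auto simp: binomial_fps_def left_diff_distrib fps_X_power_mult_nth)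
next
  case (Suc d)
  have step: "(1 - fps_X\<^sup>2) * binomial_fps (Suc d) = binomial_fps d"
  proof (rule fps_ext)
    fix m
    show "fps_nth ((1 - fps_X\<^sup>2) * binomial_fps (Suc d)) m = fps_nth (binomial_fps d) m"
    proof (cases "even m \<and> 2 \<le> m")
      case True
      then obtain j where "m = 2 * Suc j" by (metis evenE Suc_pred' mult_0_right not_gr_zero not_numeral_le_zero)
      then show ?thesis
        by (simp add: binomial_fps_def left_diff_distrib fps_X_power_mult_nth)
    next
      case False
      then have "m < 2 \<or> odd m" by auto
      then show ?thesis
        by (auto simp: binomial_fps_def left_diff_distrib fps_X_power_mult_nth less_2_cases_iff)
    qed
  qed
  have "(1 - fps_X\<^sup>2) ^ Suc (Suc d) * binomial_fps (Suc d) =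
      (1 - fps_X\<^sup>2) ^ Suc d * ((1 - fps_X\<^sup>2) * binomial_fps (Suc d))"
    by (simp only: power_Suc2 mult.assoc)
  then show ?case unfolding step Suc.IH .
qed

text \<open>Summing over all norms up to m divides W_n by 1 - q. Multiplication by (1 - q^2)^(n+1)
  instead of (1 - q^2)^n absorbs this and leaves an additional factor 1 + q in every cell, over the
  denominator (1 - q^2)^(d+1).\<close>

lemma walk_count_fps:
  assumes "1 \<le> n"
  shows "Abs_fps (\<lambda>m. \<Sum>i \<le> m. real (card (walk_lists n i))) =
    (\<Sum>S \<in> graphs n. (-1) ^ (n - card S) *
       ((if \<exists>a \<in> S. is_loop a then (1 + fps_X)\<^sup>2 else 1 + fps_X) * binomial_fps (card S)))"
    (is "?U = (\<Sum>S \<in> graphs n. ?c S)")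
proof -
  define Q :: "real fps" where "Q = 1 - fps_X\<^sup>2"
  have Q: "Q = (1 + fps_X) * (1 - fps_X)" by (simp add: Q_def algebra_simps power2_eq_square)
  have lin: "fps_of_poly [:1, 1:] = (1 + fps_X :: real fps)" by (simp add: fps_of_poly_pCons)
  have "fps_of_poly (graph_poly n) = fps_X * fps_of_poly (\<Sum>S \<in> graphs n. dual_cell_poly n S)"
    unfolding graph_poly_dual[OF assms] by (simp only: fps_of_poly_mult fps_of_poly_fps_X)
  then have "fps_X * (Q ^ n * walk_fps n) = fps_X * fps_of_poly (\<Sum>S \<in> graphs n. dual_cell_poly n S)"
    unfolding fps_of_poly_graph_poly[OF assms] strict_walk_fps_shift[OF assms] by (simp only: Q_def mult_ac)
  then have W: "Q ^ n * walk_fps n = fps_of_poly (\<Sum>S \<in> graphs n. dual_cell_poly n S)" by simp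
  have U: "(1 - fps_X) * ?U = walk_fps n"
  proof (rule fps_ext)
    fix m show "fps_nth ((1 - fps_X) * ?U) m = fps_nth (walk_fps n) m"
      by (cases m) (simp_all add: left_diff_distrib walk_fps_lists)
  qed
  have "Q ^ Suc n * ?U = (1 + fps_X) * (Q ^ n * ((1 - fps_X) * ?U))"
    unfolding power_Suc by (subst (1) Q) (simp only: mult_ac)
  also have "\<dots> = (\<Sum>S \<in> graphs n. (1 + fps_X) * fps_of_poly (dual_cell_poly n S))"
    unfolding U W fps_of_poly_sum by (simp add: sum_distrib_left)
  also have "\<dots> = (\<Sum>S \<in> graphs n. Q ^ Suc n * ?c S)"
  proof (intro sum.cong refl)
    fix S assume "S \<in> graphs n"
    then have d: "card S \<le> n" using admissible_card unfolding graphs_def by blast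
    have "Q ^ Suc n = Q ^ (n - card S) * Q ^ Suc (card S)" using d by (simp flip: power_add)
    then have "Q ^ Suc n * binomial_fps (card S) = Q ^ (n - card S) * (Q ^ Suc (card S) * binomial_fps (card S))"
      by (simp only: mult.assoc)
    also have "Q ^ Suc (card S) * binomial_fps (card S) = 1" unfolding Q_def by (rule binomial_fps_power)
    finally have *: "Q ^ Suc n * binomial_fps (card S) = Q ^ (n - card S)" by simp
    have "Q ^ Suc n * ?c S = (-1) ^ (n - card S) *
       ((if \<exists>a \<in> S. is_loop a then (1 + fps_X)\<^sup>2 else 1 + fps_X) * (Q ^ Suc n * binomial_fps (card S)))"
      by (simp only: mult_ac)
    also have "\<dots> = (1 + fps_X) * fps_of_poly (dual_cell_poly n S)"
      unfolding * dual_cell_poly_def fps_of_poly_mult fps_of_poly_power fps_of_poly_1_minus_X2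
      by (simp add: Q_def fps_of_poly_uminus lin power2_eq_square mult_ac)
    finally show "(1 + fps_X) * fps_of_poly (dual_cell_poly n S) = Q ^ Suc n * ?c S" by (rule sym)
  qed
  also have "\<dots> = Q ^ Suc n * (\<Sum>S \<in> graphs n. ?c S)" by (simp only: sum_distrib_left)
  finally show ?thesis
  proof (rule mult_left_cancel[THEN iffD1, rotated])
    have "fps_nth Q 0 \<noteq> 0" by (simp add: Q_def)
    then show "Q ^ Suc n \<noteq> 0" by (metis fps_zero_nth pow_divides_pow_iff power_not_zero)
  qed
qed

text \<open>\<open>binomial_fps d\<close> has only even exponents. At q^(2t), therefore, 1 + q
  contributes one binomial, and in (1 + q)^2 = 1 + 2q + q^2 the middle term drops out while the
  outer two contribute the binomials for t and t - 1.\<close>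

lemma walk_count:
  assumes "1 \<le> n"
  shows "int (\<Sum>i \<le> 2 * t. card (walk_lists n i)) =
    (\<Sum>S \<in> graphs n. (-1) ^ (n - card S) *
       (if \<exists>a \<in> S. is_loop a then int ((card S + t) choose card S) + int ((card S + t - 1) choose card S)
        else int ((card S + t) choose card S)))"
proof -
  have E: "fps_nth ((1 + fps_X) * binomial_fps d) (2 * t) = real ((d + t) choose d)" for d
    by (cases t) (simp_all add: binomial_fps_def distrib_right)
  \<comment> \<open>At t = 0 the q^2 term has no coefficient, and (d - 1 choose d) is 0 as well. For
    d = 0 truncated subtraction would make that binomial 1; rooted graphs have d > 0.\<close>
  have E2: "fps_nth ((1 + fps_X)\<^sup>2 * binomial_fps d) (2 * t) =
      real ((d + t) choose d) + real ((d + t - 1) choose d)" if "d \<noteq> 0" for d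
  proof -
    have "(1 + fps_X)\<^sup>2 * binomial_fps d = binomial_fps d + fps_X\<^sup>2 * binomial_fps d + fps_const 2 * (fps_X * binomial_fps d)"
      by (simp add: algebra_simps power2_eq_square numeral_fps_const)
    then show ?thesis using that
      by (cases t) (simp_all add: binomial_fps_def fps_X_power_mult_nth)
  qed
  have "real (\<Sum>i \<le> 2 * t. card (walk_lists n i)) =
      (\<Sum>S \<in> graphs n. (-1) ^ (n - card S) *
       (if \<exists>a \<in> S. is_loop a then real ((card S + t) choose card S) + real ((card S + t - 1) choose card S)
        else real ((card S + t) choose card S)))"
    using arg_cong[OF walk_count_fps[OF assms], of "\<lambda>f. fps_nth f (2 * t)"]
    unfolding fps_sum_nth
  proof (simp, intro sum.cong refl)
    fix S assume S: "S \<in> graphs n"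
    have sgn: "(-1 :: real fps) ^ k = fps_const ((-1) ^ k)" for k
      by (metis fps_const_1_eq_1 fps_const_neg fps_const_power)
    have ne: "card S \<noteq> 0"
      using S admissible_finite[of n S] unfolding graphs_def rooted_def by auto
    show "fps_nth ((-1) ^ (n - card S) *
        ((if \<exists>a \<in> S. is_loop a then (1 + fps_X)\<^sup>2 else 1 + fps_X) * binomial_fps (card S))) (2 * t) =
      (-1) ^ (n - card S) *
       (if \<exists>a \<in> S. is_loop a then real ((card S + t) choose card S) + real ((card S + t - 1) choose card S)
        else real ((card S + t) choose card S))"
      unfolding sgn fps_mult_left_const_nth using E[of "card S"] E2[OF ne] by simp
  qed
  also have "\<dots> = real_of_int (\<Sum>S \<in> graphs n. (-1) ^ (n - card S) *
       (if \<exists>a \<in> S. is_loop a then int ((card S + t) choose card S) + int ((card S + t - 1) choose card S)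
        else int ((card S + t) choose card S)))" (is "_ = real_of_int ?R")
    unfolding of_int_sum by (intro sum.cong refl) simp
  finally have eq: "real (\<Sum>i \<le> 2 * t. card (walk_lists n i)) = real_of_int ?R" .
  have "int m = z" if "real m = real_of_int z" for m z using that by linarith
  from this[OF eq] show ?thesis .
qed

lemma sum_by_card:
  fixes f :: "nat \<Rightarrow> int"
  assumes "finite A" "finite D" "card ` A \<subseteq> D"
  shows "(\<Sum>S \<in> A. f (card S)) = (\<Sum>d \<in> D. int (card {S \<in> A. card S = d}) * f d)"
proof -
  have "(\<Sum>S \<in> A. f (card S)) = (\<Sum>d \<in> D. \<Sum>S \<in> {S \<in> A. card S = d}. f (card S))"
    using assms by (rule sum.group[symmetric])
  also have "\<dots> = (\<Sum>d \<in> D. int (card {S \<in> A. card S = d}) * f d)" by (intro sum.cong) auto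
  finally show ?thesis .
qed

text \<open>Cells are grouped by their number d of edges. The ranges of d come from the root, which
  is an edge, and from the forest bound n - 1 for graphs without a loop.\<close>

lemma walk_count_graphs:
  assumes "1 \<le> n"
  shows "int (\<Sum>i \<le> 2 * t. card (walk_lists n i)) =
    (- 1) ^ n *
      ((\<Sum>d = 1..n. int (num_aww_loop n d) * (- 1) ^ d *
           (int ((d + t) choose d) + int ((d + t - 1) choose d))) +
       (\<Sum>d = 1..n - 1. int (num_aww_noloop n d) * (- 1) ^ d * int ((d + t) choose d)))"
proof -
  define L where "L = {S \<in> graphs n. \<exists>a \<in> S. is_loop a}"
  define N where "N = {S \<in> graphs n. \<not> (\<exists>a \<in> S. is_loop a)}"
  have fin: "finite L" "finite N" using finite_graphs[of n] by (simp_all add: L_def N_def)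
  have card1: "1 \<le> card S \<and> card S \<le> n" if "S \<in> graphs n" for S
  proof -
    have "card S \<noteq> 0" using that admissible_finite[of n S] unfolding graphs_def rooted_def by auto
    then show ?thesis using that admissible_card unfolding graphs_def by auto
  qed
  have cL: "card ` L \<subseteq> {1..n}" using card1 by (auto simp: L_def)
  have "card S \<le> n - 1" if "S \<in> N" for S
  proof -
    have "{a \<in> S. \<not> is_loop a} = S" using that unfolding N_def by blast
    then show ?thesis using admissible_card_noloop[of n S] that by (simp add: N_def graphs_def)
  qed
  then have cN: "card ` N \<subseteq> {1..n - 1}" using card1 by (auto simp: N_def)
  define g where "g d = int ((d + t) choose d) + int ((d + t - 1) choose d)" for d
  define h where "h d = int ((d + t) choose d)" for d
  have sgn: "(-1 :: int) ^ (n - d) = (-1) ^ n * (-1) ^ d" if "d \<le> n" for d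
    using that by (simp add: minus_one_power_iff)
  have split: "graphs n = L \<union> N" "L \<inter> N = {}" unfolding L_def N_def by auto
  have "int (\<Sum>i \<le> 2 * t. card (walk_lists n i)) =
      (\<Sum>S \<in> L. (-1) ^ (n - card S) * g (card S)) + (\<Sum>S \<in> N. (-1) ^ (n - card S) * h (card S))"
    unfolding walk_count[OF assms] split(1) sum.union_disjoint[OF fin split(2)]
    by (intro arg_cong2[where f = "(+)"] sum.cong refl) (auto simp: L_def N_def g_def h_def)
  also have "\<dots> = (\<Sum>d = 1..n. int (card {S \<in> L. card S = d}) * ((-1) ^ (n - d) * g d)) +
      (\<Sum>d = 1..n - 1. int (card {S \<in> N. card S = d}) * ((-1) ^ (n - d) * h d))"
    using sum_by_card[OF fin(1) _ cL, of "\<lambda>d. (-1) ^ (n - d) * g d"]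
      sum_by_card[OF fin(2) _ cN, of "\<lambda>d. (-1) ^ (n - d) * h d"] by simp
  also have "\<dots> = (\<Sum>d = 1..n. (- 1) ^ n * (int (num_aww_loop n d) * (- 1) ^ d * g d)) +
      (\<Sum>d = 1..n - 1. (- 1) ^ n * (int (num_aww_noloop n d) * (- 1) ^ d * h d))"
  proof (intro arg_cong2[where f = "(+)"] sum.cong refl)
    fix d assume d: "d \<in> {1..n}"
    have "{S \<in> L. card S = d} = {S. admissible n S \<and> rooted S \<and> card S = d \<and> (\<exists>a \<in> S. is_loop a)}"
      by (auto simp: L_def graphs_def)
    then show "int (card {S \<in> L. card S = d}) * ((-1) ^ (n - d) * g d) =
        (- 1) ^ n * (int (num_aww_loop n d) * (- 1) ^ d * g d)"
      using d by (simp add: num_aww_loop_eq sgn)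
  next
    fix d assume d: "d \<in> {1..n - 1}"
    then have dn: "d \<le> n" by (metis atLeastAtMost_iff diff_le_self le_trans)
    have "{S \<in> N. card S = d} = {S. admissible n S \<and> rooted S \<and> card S = d \<and> \<not> (\<exists>a \<in> S. is_loop a)}"
      by (auto simp: N_def graphs_def)
    then show "int (card {S \<in> N. card S = d}) * ((-1) ^ (n - d) * h d) =
        (- 1) ^ n * (int (num_aww_noloop n d) * (- 1) ^ d * h d)"
      using sgn[OF dn] by (simp add: num_aww_noloop_eq)
  qed
  finally show ?thesis by (simp add: g_def h_def distrib_left sum_distrib_left)
qed

subsection \<open>Lattice points of the root polytope\<close>

locale standard_basis =
  fixes e :: "nat \<Rightarrow> 'a::euclidean_space" and n :: nat
  assumes bij_e: "bij_betw e {1..n} (Basis :: 'a set)"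
begin

lemma inner_e: "i \<in> {1..n} \<Longrightarrow> j \<in> {1..n} \<Longrightarrow> e i \<bullet> e j = of_bool (i = j)"
  using bij_e inner_Basis[of "e i" "e j"] unfolding bij_betw_def
  by (metis (full_types) imageI inj_on_eq_iff of_bool_eq(1) of_bool_eq(2))

lemma n_pos: "1 \<le> n"
proof (rule ccontr)
  assume "\<not> 1 \<le> n"
  then have "(Basis :: 'a set) = {}" using bij_e by (simp add: bij_betw_def)
  then show False by simp
qed

definition embed :: "(nat \<Rightarrow> int) \<Rightarrow> 'a" where
  "embed x = (\<Sum>v = 1..n. real_of_int (x v) *\<^sub>R e v)"

lemma embed_inner: "i \<in> {1..n} \<Longrightarrow> embed x \<bullet> e i = real_of_int (x i)"
proof -
  assume i: "i \<in> {1..n}"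
  have "embed x \<bullet> e i = (\<Sum>v = 1..n. real_of_int (x v) * (e v \<bullet> e i))"
    by (simp add: embed_def inner_sum_left)
  also have "\<dots> = (\<Sum>v = 1..n. if v = i then real_of_int (x v) else 0)"
    using i by (intro sum.cong) (auto simp: inner_e)
  finally show ?thesis using i by simp
qed

lemma eq_embed_iff:
  "y = embed x \<longleftrightarrow> (\<forall>i \<in> {1..n}. y \<bullet> e i = real_of_int (x i))"
proof
  assume *: "\<forall>i \<in> {1..n}. y \<bullet> e i = real_of_int (x i)"
  show "y = embed x"
  proof (rule euclidean_eqI)
    fix b :: 'a assume "b \<in> Basis"
    then have "b \<in> e ` {1..n}" using bij_betw_imp_surj_on[OF bij_e] by simp
    then obtain i where "i \<in> {1..n}" "b = e i" by blast
    then show "y \<bullet> b = embed x \<bullet> b" using * embed_inner by simp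
  qed
qed (simp add: embed_inner)

lemma graph_cone_add:
  assumes "x \<in> graph_cone e E" "y \<in> graph_cone e E"
  shows "x + y \<in> graph_cone e E"
proof -
  obtain c d where "x = (\<Sum>a \<in> set_mset E. c a *\<^sub>R edge_vector e a)" "\<forall>a \<in># E. (0::real) \<le> c a"
    "y = (\<Sum>a \<in> set_mset E. d a *\<^sub>R edge_vector e a)" "\<forall>a \<in># E. (0::real) \<le> d a"
    using assms unfolding graph_cone_def by blast
  then have "x + y = (\<Sum>a \<in> set_mset E. (c a + d a) *\<^sub>R edge_vector e a)" "\<forall>a \<in># E. 0 \<le> c a + d a"
    by (auto simp: scaleR_add_left sum.distrib)
  then show ?thesis unfolding graph_cone_def by (intro CollectI exI[of _ "\<lambda>a. c a + d a"]) simp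
qed

lemma edge_in_graph_cone:
  assumes "a \<in># E" shows "edge_vector e a \<in> graph_cone e E"
proof -
  have "edge_vector e a = (\<Sum>b \<in> set_mset E. (if b = a then 1 else 0 :: real) *\<^sub>R edge_vector e b)"
    using assms by (simp add: if_distrib[of "\<lambda>c. c *\<^sub>R _"] cong: if_cong)
  then show ?thesis unfolding graph_cone_def
    by (intro CollectI exI[of _ "\<lambda>b. if b = a then 1 else 0 :: real"]) simp
qed

lemma zero_in_graph_cone: "0 \<in> graph_cone e E"
  unfolding graph_cone_def by (intro CollectI exI[of _ "\<lambda>_. 0"]) simp

text \<open>The edges of the path and its loop are the simple roots of type C_n. Differences
  telescope along the path, and e_i + e_j = (e_i - e_n) + (e_j - e_n) + 2 e_n.\<close>

lemma positive_roots_cone: "positive_roots e n \<subseteq> graph_cone e (loop_path n)"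
proof -
  let ?C = "graph_cone e (loop_path n)"
  have step: "e i - e (Suc i) \<in> ?C" if "i \<in> {1..n - 1}" for i
    using edge_in_graph_cone[of "(i, i + 1, Neg)" "loop_path n"] that
    by (simp add: loop_path_def edge_vector_def)
  have last: "e n + e n \<in> ?C"
    using edge_in_graph_cone[of "(n, n, Pos)" "loop_path n"]
    by (simp add: loop_path_def edge_vector_def)
  have diff: "1 \<le> i \<Longrightarrow> i \<le> j \<Longrightarrow> j \<le> n \<Longrightarrow> e i - e j \<in> ?C" for i j
  proof (induction j)
    case (Suc j)
    show ?case
    proof (cases "i = Suc j")
      case False
      then have "e i - e j \<in> ?C" "e j - e (Suc j) \<in> ?C" using Suc step[of j] by auto
      then show ?thesis using graph_cone_add by fastforce
    qed (simp add: zero_in_graph_cone)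
  qed simp
  have plus: "e i + e j \<in> ?C" if "1 \<le> i" "i \<le> n" "1 \<le> j" "j \<le> n" for i j
  proof -
    have "e i - e n \<in> ?C" "e j - e n \<in> ?C" using diff that by auto
    then have "(e i - e n) + (e j - e n) + (e n + e n) \<in> ?C"
      using last graph_cone_add by blast
    then show ?thesis by simp
  qed
  have "2 *\<^sub>R e k \<in> ?C" if "1 \<le> k" "k \<le> n" for k
    using plus[of k k] that by (simp add: scaleR_2)
  then show ?thesis using diff plus unfolding positive_roots_def by force
qed

lemma root_polytope_loop_path: "root_polytope e n (loop_path n) = convex hull ({0} \<union> positive_roots e n)"
  unfolding root_polytope_def using positive_roots_cone by (simp add: Int_absorb2)

text \<open>An outer description of the polytope, by inequalities. The polytope is shown to lie
  inside it; the converse is obtained for the integer points of the dilates, through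
  \<open>mvec_surj\<close>, instead of by an analysis of the facets.\<close>

definition walk_body :: "'a set" where
  "walk_body = {y. (\<forall>k \<le> n. 0 \<le> (\<Sum>v = 1..k. y \<bullet> e v)) \<and> (\<Sum>v = 1..n. \<bar>y \<bullet> e v\<bar>) \<le> 2}"

lemma convex_walk_body: "convex walk_body"
proof (rule convexI)
  fix x y :: 'a and u v :: real
  assume xy: "x \<in> walk_body" "y \<in> walk_body" and uv: "0 \<le> u" "0 \<le> v" "u + v = 1"
  have "(\<Sum>i = 1..k. (u *\<^sub>R x + v *\<^sub>R y) \<bullet> e i) = u * (\<Sum>i = 1..k. x \<bullet> e i) + v * (\<Sum>i = 1..k. y \<bullet> e i)" for k
    by (simp add: inner_add_left sum.distrib sum_distrib_left)
  then have "\<forall>k \<le> n. 0 \<le> (\<Sum>i = 1..k. (u *\<^sub>R x + v *\<^sub>R y) \<bullet> e i)"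
    using xy uv unfolding walk_body_def by simp
  moreover have "(\<Sum>i = 1..n. \<bar>(u *\<^sub>R x + v *\<^sub>R y) \<bullet> e i\<bar>) \<le> 2"
  proof -
    have "(\<Sum>i = 1..n. \<bar>(u *\<^sub>R x + v *\<^sub>R y) \<bullet> e i\<bar>) \<le> (\<Sum>i = 1..n. u * \<bar>x \<bullet> e i\<bar> + v * \<bar>y \<bullet> e i\<bar>)"
    proof (rule sum_mono)
      fix i
      show "\<bar>(u *\<^sub>R x + v *\<^sub>R y) \<bullet> e i\<bar> \<le> u * \<bar>x \<bullet> e i\<bar> + v * \<bar>y \<bullet> e i\<bar>"
        using abs_triangle_ineq[of "u * (x \<bullet> e i)" "v * (y \<bullet> e i)"] uv
        by (simp add: inner_add_left abs_mult)
    qed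
    then have "(\<Sum>i = 1..n. \<bar>(u *\<^sub>R x + v *\<^sub>R y) \<bullet> e i\<bar>) \<le> u * (\<Sum>i = 1..n. \<bar>x \<bullet> e i\<bar>) + v * (\<Sum>i = 1..n. \<bar>y \<bullet> e i\<bar>)"
      by (simp add: sum.distrib sum_distrib_left)
    also have "\<dots> \<le> u * 2 + v * 2"
      using xy uv unfolding walk_body_def by (intro add_mono mult_left_mono) auto
    also have "\<dots> = 2" using uv by (simp flip: distrib_right)
    finally show ?thesis .
  qed
  ultimately show "u *\<^sub>R x + v *\<^sub>R y \<in> walk_body" unfolding walk_body_def by simp
qed

lemma root_in_walk_body:
  assumes "1 \<le> i" "i \<le> j" "j \<le> n" "s = 1 \<or> s = -1"
  shows "e i + s *\<^sub>R e j \<in> walk_body"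
proof -
  have ip: "(e i + s *\<^sub>R e j) \<bullet> e v = of_bool (v = i) + s * of_bool (v = j)" if "v \<in> {1..n}" for v
    using assms that by (auto simp: inner_add_left inner_e)
  have one: "(\<Sum>v = 1..k. of_bool (v = m)) = (of_bool (1 \<le> m \<and> m \<le> k) :: real)" for m k :: nat
    by (simp add: of_bool_def)
  have "(\<Sum>v = 1..k. (e i + s *\<^sub>R e j) \<bullet> e v) = of_bool (i \<le> k) + s * of_bool (j \<le> k)" if "k \<le> n" for k
  proof -
    have "(\<Sum>v = 1..k. (e i + s *\<^sub>R e j) \<bullet> e v) = (\<Sum>v = 1..k. of_bool (v = i) + s * of_bool (v = j))"
      using that by (intro sum.cong refl ip) auto
    then show ?thesis using assms by (simp add: sum.distrib one flip: sum_distrib_left)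
  qed
  moreover have "(\<Sum>v = 1..n. \<bar>(e i + s *\<^sub>R e j) \<bullet> e v\<bar>) \<le> (\<Sum>v = 1..n. of_bool (v = i) + of_bool (v = j))"
    using assms(4) by (intro sum_mono) (auto simp: ip)
  then have "(\<Sum>v = 1..n. \<bar>(e i + s *\<^sub>R e j) \<bullet> e v\<bar>) \<le> 2"
    using assms by (simp add: sum.distrib one)
  moreover have "0 \<le> of_bool (i \<le> k) + s * of_bool (j \<le> k)" for k
    using assms by auto
  ultimately show ?thesis unfolding walk_body_def by simp
qed

lemma root_polytope_subset: "convex hull ({0} \<union> positive_roots e n) \<subseteq> walk_body"
proof (rule hull_minimal)
  have "e i - e j \<in> walk_body" if "1 \<le> i" "i \<le> j" "j \<le> n" for i j
    using root_in_walk_body[OF that, of "-1"] by simp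
  moreover have plus: "e i + e j \<in> walk_body" if "1 \<le> i" "i \<le> j" "j \<le> n" for i j
    using root_in_walk_body[OF that, of 1] by simp
  moreover have "2 *\<^sub>R e k \<in> walk_body" if "1 \<le> k" "k \<le> n" for k
    using plus[of k k] that by (simp add: scaleR_2)
  moreover have "0 \<in> walk_body" by (simp add: walk_body_def)
  ultimately show "{0} \<union> positive_roots e n \<subseteq> walk_body"
    unfolding positive_roots_def by force
qed (rule convex_walk_body)

lemma embed_half_vec:
  assumes "1 \<le> i" "i \<le> j" "j \<le> n" "i = j \<longrightarrow> s = Pos"
  shows "\<exists>r \<in> positive_roots e n. embed (half_vec (i, j, s)) = (real (weight (i, j, s)) / 2) *\<^sub>R r"
proof (cases "i = j")
  case True
  have "embed (half_vec (i, j, s)) = (1 / 2) *\<^sub>R (2 *\<^sub>R e i)"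
    by (rule sym, subst eq_embed_iff) (use assms True in \<open>auto simp: inner_e half_vec_def\<close>)
  moreover have "2 *\<^sub>R e i \<in> positive_roots e n" using assms True unfolding positive_roots_def by blast
  moreover have "real (weight (i, j, s)) / 2 = 1 / 2" using True by (simp add: weight_def is_loop_def)
  ultimately show ?thesis by metis
next
  case False
  then have ij: "i < j" using assms by simp
  show ?thesis
  proof (cases s)
    case Pos
    have "embed (half_vec (i, j, s)) = e i + e j"
      by (rule sym, subst eq_embed_iff) (use assms False Pos in \<open>auto simp: inner_e inner_add_left half_vec_def\<close>)
    moreover have "e i + e j \<in> positive_roots e n" using assms ij unfolding positive_roots_def by blast
    ultimately show ?thesis using False by (auto simp: weight_def is_loop_def)
  next
    case Neg
    have "embed (half_vec (i, j, s)) = e i - e j"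
      by (rule sym, subst eq_embed_iff) (use assms False Neg in \<open>auto simp: inner_e inner_diff_left half_vec_def\<close>)
    moreover have "e i - e j \<in> positive_roots e n" using assms ij unfolding positive_roots_def by blast
    ultimately show ?thesis using False by (auto simp: weight_def is_loop_def)
  qed
qed

text \<open>Half the weight of an edge is the coefficient of its root: 1/2 for 2 e_i in the case of
  a loop, 1 otherwise. Normalized weights therefore serve as coefficients of a convex combination of
  roots, and half the total weight is the dilation factor.\<close>

lemma embed_mvec:
  assumes "admissible n (set_mset M)"
  shows "\<exists>h \<in> convex hull ({0} \<union> positive_roots e n). embed (mvec M) = (real (total_weight M) / 2) *\<^sub>R h"
  using assms
proof (induction M)
  case empty
  have "0 \<in> convex hull ({0} \<union> positive_roots e n)" by (rule hull_inc) simp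
  then show ?case by (intro bexI[of _ 0]) (simp_all add: embed_def)
next
  case (add a M)
  let ?H = "convex hull ({0} \<union> positive_roots e n)"
  have "admissible n (set_mset M)" using add.prems by (auto intro: admissible_subset)
  then obtain h where h: "h \<in> ?H" "embed (mvec M) = (real (total_weight M) / 2) *\<^sub>R h"
    using add.IH by blast
  obtain i j s where a: "a = (i, j, s)" by (metis prod_cases3)
  then have "(i, j, s) \<in> set_mset (add_mset a M)" by simp
  note E = admissible_edge[OF add.prems this]
  obtain r where r: "r \<in> positive_roots e n" "embed (half_vec a) = (real (weight a) / 2) *\<^sub>R r"
    using embed_half_vec[of i j s] E unfolding a by blast
  have "r \<in> ?H" using r(1) by (intro hull_inc) simp
  define W where "W = real (total_weight M)"
  define w where "w = real (weight a)"
  \<comment> \<open>W may be 0, but w > 0 keeps the denominator W + w of the new convex combination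
    from vanishing.\<close>
  have W: "0 \<le> W" "0 < w" by (auto simp: W_def w_def weight_def)
  define h' where "h' = (W / (W + w)) *\<^sub>R h + (w / (W + w)) *\<^sub>R r"
  have "h' \<in> ?H" unfolding h'_def
    using W h(1) \<open>r \<in> ?H\<close> by (intro convexD[OF convex_convex_hull]) (auto simp flip: add_divide_distrib)
  have "embed (mvec (add_mset a M)) = embed (half_vec a) + embed (mvec M)"
    by (simp add: embed_def scaleR_add_left sum.distrib)
  also have "\<dots> = (W / 2) *\<^sub>R h + (w / 2) *\<^sub>R r" using h(2) r(2) by (simp add: W_def w_def)
  also have "\<dots> = ((W + w) / 2) *\<^sub>R h'"
  proof -
    have "(W + w) / 2 * (W / (W + w)) = W / 2" "(W + w) / 2 * (w / (W + w)) = w / 2"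
      using W by (simp_all add: field_simps)
    then show ?thesis unfolding h'_def scaleR_add_right scaleR_scaleR by (simp only:)
  qed
  also have "W + w = real (total_weight (add_mset a M))" by (simp add: W_def w_def)
  finally show ?case using \<open>h' \<in> ?H\<close> by blast
qed

lemma dilate_integer_points:
  "(\<lambda>x. real t *\<^sub>R x) ` root_polytope e n (loop_path n) \<inter> integer_points =
    embed ` {x. walk n x \<and> (\<Sum>v = 1..n. \<bar>x v\<bar>) \<le> int (2 * t)}"
  unfolding root_polytope_loop_path
proof (intro equalityI subsetI)
  let ?H = "convex hull ({0} \<union> positive_roots e n)"
  fix y assume y: "y \<in> (\<lambda>x. real t *\<^sub>R x) ` ?H \<inter> integer_points"
  then obtain h where h: "h \<in> ?H" "y = real t *\<^sub>R h" by blast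
  have hb: "h \<in> walk_body" using h(1) root_polytope_subset by blast
  define x where "x v = (if v \<in> {1..n} then \<lfloor>y \<bullet> e v\<rfloor> else 0)" for v
  have x: "real_of_int (x v) = y \<bullet> e v" if "v \<in> {1..n}" for v
  proof -
    have "e v \<in> Basis" using bij_e that by (auto simp: bij_betw_def)
    then have "y \<bullet> e v \<in> \<int>" using y unfolding integer_points_def by blast
    then show ?thesis using that by (auto simp: x_def elim: Ints_cases)
  qed
  have "0 \<le> (\<Sum>v = 1..k. x v)" if "k \<le> n" for k
  proof -
    have "real_of_int (\<Sum>v = 1..k. x v) = (\<Sum>v = 1..k. y \<bullet> e v)"
      using that unfolding of_int_sum by (intro sum.cong x) auto
    also have "\<dots> = real t * (\<Sum>v = 1..k. h \<bullet> e v)" unfolding h(2) by (simp add: sum_distrib_left)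
    also have "0 \<le> \<dots>" using hb that unfolding walk_body_def by simp
    finally show ?thesis by (simp only: of_int_0_le_iff)
  qed
  then have "walk n x" unfolding walk_def by (auto simp: x_def)
  moreover have "real_of_int (\<Sum>v = 1..n. \<bar>x v\<bar>) \<le> real_of_int (int (2 * t))"
  proof -
    have "real_of_int (\<Sum>v = 1..n. \<bar>x v\<bar>) = (\<Sum>v = 1..n. \<bar>y \<bullet> e v\<bar>)"
      unfolding of_int_sum of_int_abs by (intro sum.cong) (auto simp: x)
    also have "\<dots> = real t * (\<Sum>v = 1..n. \<bar>h \<bullet> e v\<bar>)"
      unfolding h(2) by (simp add: sum_distrib_left abs_mult)
    also have "\<dots> \<le> real t * 2" using hb unfolding walk_body_def by (intro mult_left_mono) auto
    finally show ?thesis by simp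
  qed
  moreover have "y = embed x" using x by (simp add: eq_embed_iff)
  ultimately show "y \<in> embed ` {x. walk n x \<and> (\<Sum>v = 1..n. \<bar>x v\<bar>) \<le> int (2 * t)}"
    unfolding of_int_le_iff by blast
next
  let ?H = "convex hull ({0} \<union> positive_roots e n)"
  fix y assume "y \<in> embed ` {x. walk n x \<and> (\<Sum>v = 1..n. \<bar>x v\<bar>) \<le> int (2 * t)}"
  then obtain x where x: "y = embed x" "walk n x" "(\<Sum>v = 1..n. \<bar>x v\<bar>) \<le> int (2 * t)" by blast
  obtain M where M: "admissible n (set_mset M)" "mvec M = x" using mvec_surj[OF x(2)] .
  obtain h where h: "h \<in> ?H" "embed x = (real (total_weight M) / 2) *\<^sub>R h"
    using embed_mvec[OF M(1)] M(2) by blast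
  have W: "total_weight M \<le> 2 * t" using x(3) mvec_l1[OF M(1)] M(2) by simp
  have "y \<in> (\<lambda>x. real t *\<^sub>R x) ` ?H"
  \<comment> \<open>For t = 0 the total weight is 0 and y is the origin; otherwise it is possible to
    divide by t.\<close>
  proof (cases "t = 0")
    case True
    then show ?thesis using h W x(1) by (intro image_eqI[of _ _ h]) auto
  next
    case False
    \<comment> \<open>The ratio of the factor W/2 from \<open>embed_mvec\<close> to t. It is at most
      1, so c h lies between h and the vertex 0 of the polytope.\<close>
    define c where "c = real (total_weight M) / (2 * real t)"
    have c: "0 \<le> c" "c \<le> 1" using W False by (auto simp: c_def field_simps)
    have z: "0 \<in> ?H" by (rule hull_inc) simp
    have "c *\<^sub>R h + (1 - c) *\<^sub>R 0 \<in> ?H"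
      using c h(1) z by (intro convexD[OF convex_convex_hull]) auto
    then have "c *\<^sub>R h \<in> ?H" by simp
    moreover have "y = real t *\<^sub>R (c *\<^sub>R h)" using h(2) x(1) False by (simp add: c_def)
    ultimately show ?thesis by blast
  qed
  moreover have "y \<in> integer_points"
  proof -
    have "y \<bullet> b \<in> \<int>" if "b \<in> Basis" for b
    proof -
      have "b \<in> e ` {1..n}" using bij_betw_imp_surj_on[OF bij_e] that by simp
      then obtain i where "i \<in> {1..n}" "b = e i" by blast
      then show ?thesis using embed_inner x(1) by simp
    qed
    then show ?thesis unfolding integer_points_def by blast
  qed
  ultimately show "y \<in> (\<lambda>x. real t *\<^sub>R x) ` ?H \<inter> integer_points" by blast
qed

lemma ehrhart_walk_lists:
  "ehrhart (root_polytope e n (loop_path n)) t = (\<Sum>m \<le> 2 * t. card (walk_lists n m))"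
proof -
  have "inj_on embed {x. walk n x \<and> (\<Sum>v = 1..n. \<bar>x v\<bar>) \<le> int (2 * t)}"
  proof (rule inj_onI)
    fix x y assume xy: "x \<in> {x. walk n x \<and> (\<Sum>v = 1..n. \<bar>x v\<bar>) \<le> int (2 * t)}"
      "y \<in> {x. walk n x \<and> (\<Sum>v = 1..n. \<bar>x v\<bar>) \<le> int (2 * t)}" "embed x = embed y"
    show "x = y"
    proof
      fix v
      show "x v = y v"
      proof (cases "v \<in> {1..n}")
        case True
        then show ?thesis using embed_inner[of v x] embed_inner[of v y] xy(3) by simp
      next
        case False
        then show ?thesis using xy(1,2) unfolding walk_def by simp
      qed
    qed
  qed
  then have "ehrhart (root_polytope e n (loop_path n)) t =
      card {x. walk n x \<and> (\<Sum>v = 1..n. \<bar>x v\<bar>) \<le> int (2 * t)}"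
    unfolding ehrhart_def dilate_integer_points by (rule card_image)
  also have "\<dots> = card (\<Union>m \<le> 2 * t. walk_lists n m)"
  proof (rule card_fun_of_list)
    fix xs :: "int list" assume l: "length xs = n"
    have "(\<Sum>v = 1..k. fun_of_list n xs v) = sum_list (take k xs)" if "k \<le> n" for k
      using fun_of_list_prefix[OF l that, of "\<lambda>x. x"] by simp
    then have w: "walk n (fun_of_list n xs) \<longleftrightarrow> (\<forall>k \<le> n. 0 \<le> sum_list (take k xs))"
      by (auto simp: walk_def fun_of_list_def)
    have "(\<Sum>v = 1..n. \<bar>fun_of_list n xs v\<bar>) = (\<Sum>x \<leftarrow> xs. \<bar>x\<bar>)"
      using fun_of_list_prefix[OF l le_refl, of abs] l by simp
    moreover have "(\<Sum>x \<leftarrow> xs. \<bar>x\<bar>) \<le> int (2 * t) \<longleftrightarrow> (\<exists>m \<le> 2 * t. (\<Sum>x \<leftarrow> xs. \<bar>x\<bar>) = int m)"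
      using sum_list_abs_nonneg[of xs] by (metis of_nat_le_iff zero_le_imp_eq_int)
    ultimately show "(walk n (fun_of_list n xs) \<and> (\<Sum>v = 1..n. \<bar>fun_of_list n xs v\<bar>) \<le> int (2 * t)) =
        (xs \<in> (\<Union>m \<le> 2 * t. walk_lists n m))"
      unfolding w using l by (auto simp: walk_lists_def l1_lists_def)
  qed (auto simp: walk_def walk_lists_def l1_lists_def)
  also have "\<dots> = (\<Sum>m \<le> 2 * t. card (walk_lists n m))"
  proof (rule card_UN_disjoint)
    show "\<forall>m \<in> {..2 * t}. finite (walk_lists n m)"
      using finite_l1_lists[of n] unfolding walk_lists_def by simp
  qed (auto simp: walk_lists_def l1_lists_def)
  finally show ?thesis .
qed

end

theorem theorem33:
  fixes n t :: nat and e :: "nat \<Rightarrow> 'a::euclidean_space"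
  assumes "bij_betw e {1..n} (Basis :: 'a set)"
  shows "int (ehrhart (root_polytope e n (loop_path n)) t) =
    (- 1) ^ n *
      ((\<Sum>d = 1..n. int (num_aww_loop n d) * (- 1) ^ d *
           (int ((d + t) choose d) + int ((d + t - 1) choose d))) +
       (\<Sum>d = 1..n - 1. int (num_aww_noloop n d) * (- 1) ^ d * int ((d + t) choose d)))"
proof -
  interpret standard_basis e n using assms by unfold_locales
  show ?thesis unfolding ehrhart_walk_lists by (rule walk_count_graphs[OF n_pos])
qed

end
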